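(* For every integer $n \geq 0$, $$\int_{\mathbb{Z}_p} \binom{x/2}{n}\, d\mu_{-1}(x) = \frac{(-1)^n}{4^n} C_n = \frac{(-1)^n}{4^n (n+1)}\binom{2n}{n}.$$
   Context: Let $p$ be a fixed odd prime, $\mathbb{Z}_p$ the ring of $p$-adic integers. For a continuous function $f:\mathbb{Z}_p\to\mathbb{C}_p$, the fermionic $p$-adic integral on $\mathbb{Z}_p$ is $\int_{\mathbb{Z}_p} f(x)\,d\mu_{-1}(x) = \lim_{N\to\infty}\sum_{x=0}^{p^N-1} f(x)(-1)^x$. Here $\binom{x/2}{n} = \frac{(x/2)(x/2-1)\cdots(x/2-n+1)}{n!}$ (a polynomial in $x$, continuous on $\mathbb{Z}_p$ since $2$ is a unit), and $C_n = \frac{1}{n+1}\binom{2n}{n}$ is the $n$-th Catalan number. *)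

theory Defs
  imports Complex_Main "HOL-Library.Cardinality" "HOL-Algebra.Algebraic_Closure_Type"
begin

text \<open>
  Fields of characteristic 0 with a non-archimedean absolute value. The library's \<open>norm\<close> is only
  available for real normed vector spaces, hence the separate constant \<open>vabs\<close>.
\<close>

class nonarch_field = field_char_0 + metric_space +
  fixes vabs :: "'a \<Rightarrow> real"
  assumes dist_vabs: "dist x y = vabs (x - y)"
    and vabs_mult: "vabs (x * y) = vabs x * vabs y"
    and vabs_add: "vabs (x + y) \<le> max (vabs x) (vabs y)"
begin

lemma vabs_nonneg: "0 \<le> vabs x"
  using dist_vabs[of x 0] zero_le_dist[of x 0] by simp

lemma vabs_eq_0: "vabs x = 0 \<longleftrightarrow> x = 0"
  using dist_vabs[of x 0] by (metis diff_zero dist_eq_0_iff)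

lemma vabs_0 [simp]: "vabs 0 = 0"
  using vabs_eq_0 by blast

lemma vabs_1 [simp]: "vabs 1 = 1"
proof -
  have "vabs 1 * vabs 1 = vabs 1" by (simp flip: vabs_mult)
  thus ?thesis by (simp add: vabs_eq_0)
qed

lemma vabs_minus [simp]: "vabs (- x) = vabs x"
proof -
  have "vabs x = dist x 0" "vabs (- x) = dist 0 x"
    by (simp_all add: dist_vabs)
  thus ?thesis by (simp add: dist_commute)
qed

lemma vabs_minus_commute: "vabs (x - y) = vabs (y - x)"
  by (metis vabs_minus minus_diff_eq)

lemma vabs_triangle: "vabs (x + y) \<le> vabs x + vabs y"
  using vabs_add[of x y] vabs_nonneg[of x] vabs_nonneg[of y] by linarith

end

lemma vabs_inverse:
  fixes x y :: "'a :: nonarch_field"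
  shows "vabs (inverse x) = inverse (vabs x)"
proof (cases "x = 0")
  case False
  hence "vabs (inverse x) * vabs x = 1"
    by (simp flip: vabs_mult)
  thus ?thesis
    using inverse_unique[of "vabs x" "vabs (inverse x)"] by (simp add: mult.commute)
qed auto

lemma vabs_divide:
  fixes x y :: "'a :: nonarch_field"
  shows "vabs (x / y) = vabs x / vabs y"
  by (simp add: divide_inverse vabs_mult vabs_inverse)

lemma vabs_power:
  fixes x y :: "'a :: nonarch_field"
  shows "vabs (x ^ n) = vabs x ^ n"
  by (induction n) (auto simp: vabs_mult)

lemma vabs_diff_vabs:
  fixes x y :: "'a :: nonarch_field"
  shows "\<bar>vabs x - vabs y\<bar> \<le> vabs (x - y)"
  using vabs_triangle[of "x - y" y] vabs_triangle[of "y - x" x]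
  by (simp add: vabs_minus_commute[of y x])

lemma null_seq_iff: "S \<longlonglongrightarrow> (0 :: 'a :: nonarch_field) \<longleftrightarrow> (\<lambda>n. vabs (S n)) \<longlonglongrightarrow> 0"
  by (subst tendsto_dist_iff) (simp add: dist_vabs)

lemma null_seq_add:
  fixes S T :: "nat \<Rightarrow> 'a :: nonarch_field"
  assumes "S \<longlonglongrightarrow> 0" "T \<longlonglongrightarrow> 0"
  shows "(\<lambda>n. S n + T n) \<longlonglongrightarrow> 0"
proof -
  have "(\<lambda>n. vabs (S n) + vabs (T n)) \<longlonglongrightarrow> 0"
    using tendsto_add[OF assms[unfolded null_seq_iff]] by simp
  thus ?thesis
    unfolding null_seq_iff
    by (rule tendsto_sandwich[OF _ _ tendsto_const, rotated 2])
       (auto intro!: always_eventually simp: vabs_nonneg vabs_triangle)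
qed

lemma null_seq_minus:
  fixes S :: "nat \<Rightarrow> 'a :: nonarch_field"
  shows "(\<lambda>n. - S n) \<longlonglongrightarrow> 0 \<longleftrightarrow> S \<longlonglongrightarrow> 0"
  by (simp add: null_seq_iff)

lemma null_seq_diff:
  fixes S T :: "nat \<Rightarrow> 'a :: nonarch_field"
  assumes "S \<longlonglongrightarrow> 0" "T \<longlonglongrightarrow> 0"
  shows "(\<lambda>n. S n - T n) \<longlonglongrightarrow> 0"
  using null_seq_add[OF assms(1), of "\<lambda>n. - T n"] assms(2) by (simp add: null_seq_minus)

lemma null_seq_mult_Bseq:
  fixes S T :: "nat \<Rightarrow> 'a :: nonarch_field"
  assumes "\<And>n. vabs (S n) \<le> B" "T \<longlonglongrightarrow> 0"
  shows "(\<lambda>n. S n * T n) \<longlonglongrightarrow> 0"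
proof -
  have "(\<lambda>n. B * vabs (T n)) \<longlonglongrightarrow> 0"
    using tendsto_mult[OF tendsto_const assms(2)[unfolded null_seq_iff], of B] by simp
  thus ?thesis
    unfolding null_seq_iff
    by (rule tendsto_sandwich[OF _ _ tendsto_const, rotated 2])
       (auto intro!: always_eventually mult_right_mono simp: vabs_nonneg vabs_mult assms)
qed

lemma Cauchy_nonarch_iff:
  fixes S :: "nat \<Rightarrow> 'a :: nonarch_field"
  shows "Cauchy S \<longleftrightarrow> (\<forall>e>0. \<exists>N. \<forall>m\<ge>N. \<forall>n\<ge>N. vabs (S m - S n) < e)"
  by (simp add: Cauchy_def dist_vabs)

lemma Cauchy_nonarch_bounded:
  fixes S :: "nat \<Rightarrow> 'a :: nonarch_field"
  assumes "Cauchy S"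
  obtains B where "B > 0" "\<And>n. vabs (S n) \<le> B"
proof -
  obtain N where N: "vabs (S m - S n) < 1" if "m \<ge> N" "n \<ge> N" for m n
    using assms unfolding Cauchy_nonarch_iff by (metis zero_less_one)
  define B where "B = Max ((\<lambda>n. vabs (S n)) ` {..N}) + 1"
  have B: "vabs (S n) + 1 \<le> B" if "n \<le> N" for n
    using that unfolding B_def by auto
  show ?thesis
  proof (rule that[of B])
    show "B > 0"
      using B[of 0] vabs_nonneg[of "S 0"] by simp
    show "vabs (S n) \<le> B" for n
    proof (cases "n \<le> N")
      case False
      thus ?thesis
        using N[of n N] B[of N] vabs_triangle[of "S n - S N" "S N"] by simp
    qed (use B[of n] in simp)
  qed
qed

lemma Cauchy_nonarch_add:
  fixes S T :: "nat \<Rightarrow> 'a :: nonarch_field"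
  assumes "Cauchy S" "Cauchy T"
  shows "Cauchy (\<lambda>n. S n + T n)"
  unfolding Cauchy_nonarch_iff
proof (intro allI impI)
  fix e :: real assume "e > 0"
  obtain M where M: "\<And>m n. m \<ge> M \<Longrightarrow> n \<ge> M \<Longrightarrow> vabs (S m - S n) < e"
    using assms(1) \<open>e > 0\<close> unfolding Cauchy_nonarch_iff by meson
  obtain N where N: "\<And>m n. m \<ge> N \<Longrightarrow> n \<ge> N \<Longrightarrow> vabs (T m - T n) < e"
    using assms(2) \<open>e > 0\<close> unfolding Cauchy_nonarch_iff by meson
  have "vabs ((S m + T m) - (S n + T n)) < e" if "m \<ge> max M N" "n \<ge> max M N" for m n
    using M[of m n] N[of m n] that vabs_add[of "S m - S n" "T m - T n"]
    by (simp add: add_diff_add)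
  thus "\<exists>N. \<forall>m\<ge>N. \<forall>n\<ge>N. vabs ((S m + T m) - (S n + T n)) < e"
    by blast
qed

lemma Cauchy_nonarch_minus:
  fixes S :: "nat \<Rightarrow> 'a :: nonarch_field"
  shows "Cauchy S \<Longrightarrow> Cauchy (\<lambda>n. - S n)"
  unfolding Cauchy_nonarch_iff minus_diff_minus vabs_minus .

lemma Cauchy_nonarch_diff:
  fixes S T :: "nat \<Rightarrow> 'a :: nonarch_field"
  assumes "Cauchy S" "Cauchy T"
  shows "Cauchy (\<lambda>n. S n - T n)"
  using Cauchy_nonarch_add[OF assms(1) Cauchy_nonarch_minus[OF assms(2)]] by simp

lemma Cauchy_nonarch_mult:
  fixes S T :: "nat \<Rightarrow> 'a :: nonarch_field"
  assumes "Cauchy S" "Cauchy T"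
  shows "Cauchy (\<lambda>n. S n * T n)"
  unfolding Cauchy_nonarch_iff
proof (intro allI impI)
  fix e :: real assume "e > 0"
  obtain A where A: "A > 0" "\<And>n. vabs (S n) \<le> A" using Cauchy_nonarch_bounded[OF assms(1)] by blast
  obtain B where B: "B > 0" "\<And>n. vabs (T n) \<le> B" using Cauchy_nonarch_bounded[OF assms(2)] by blast
  obtain M where M: "\<And>m n. m \<ge> M \<Longrightarrow> n \<ge> M \<Longrightarrow> vabs (S m - S n) < e / B"
    using assms(1) \<open>e > 0\<close> B unfolding Cauchy_nonarch_iff by (meson divide_pos_pos)
  obtain N where N: "\<And>m n. m \<ge> N \<Longrightarrow> n \<ge> N \<Longrightarrow> vabs (T m - T n) < e / A"
    using assms(2) \<open>e > 0\<close> A unfolding Cauchy_nonarch_iff by (meson divide_pos_pos)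
  have "vabs (S m * T m - S n * T n) < e" if mn: "m \<ge> max M N" "n \<ge> max M N" for m n
  proof -
    have "vabs (S m * (T m - T n)) \<le> A * vabs (T m - T n)"
      unfolding vabs_mult using A by (intro mult_right_mono) (auto simp: vabs_nonneg)
    also have "\<dots> < e" using N[of m n] mn A by (simp add: field_simps)
    finally have 1: "vabs (S m * (T m - T n)) < e" .
    have "vabs ((S m - S n) * T n) \<le> vabs (S m - S n) * B"
      unfolding vabs_mult using B by (intro mult_left_mono) (auto simp: vabs_nonneg)
    also have "\<dots> < e" using M[of m n] mn B by (simp add: field_simps)
    finally have 2: "vabs ((S m - S n) * T n) < e" .
    show ?thesis
      unfolding mult_diff_mult
      using vabs_add[of "S m * (T m - T n)" "(S m - S n) * T n"] 1 2 by linarith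
  qed
  thus "\<exists>N. \<forall>m\<ge>N. \<forall>n\<ge>N. vabs (S m * T m - S n * T n) < e"
    by blast
qed

lemma Cauchy_vabs:
  fixes S :: "nat \<Rightarrow> 'a :: nonarch_field"
  assumes "Cauchy S"
  shows "Cauchy (\<lambda>n. vabs (S n))"
  using assms vabs_diff_vabs
  unfolding Cauchy_nonarch_iff Cauchy_def dist_real_def by (meson order_le_less_trans)

lemma Cauchy_nonarch_not_null:
  fixes S :: "nat \<Rightarrow> 'a :: nonarch_field"
  assumes "Cauchy S" "\<not> S \<longlonglongrightarrow> 0"
  obtains b N where "b > 0" "\<And>n. n \<ge> N \<Longrightarrow> vabs (S n) \<ge> b"
proof -
  obtain l where l: "(\<lambda>n. vabs (S n)) \<longlonglongrightarrow> l"
    using Cauchy_vabs[OF assms(1)] by (meson Cauchy_convergent convergent_def)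
  have "l \<ge> 0"
    using l by (rule LIMSEQ_le_const) (auto simp: vabs_nonneg)
  moreover have "l \<noteq> 0"
    using l assms(2) by (auto simp: null_seq_iff)
  ultimately have "l > 0" by simp
  hence "eventually (\<lambda>n. vabs (S n) > l / 2) sequentially"
    using l by (intro order_tendstoD(1)[OF l]) auto
  then obtain N where "\<And>n. n \<ge> N \<Longrightarrow> vabs (S n) > l / 2"
    by (auto simp: eventually_at_top_linorder)
  with \<open>l > 0\<close> show ?thesis
    by (intro that[of "l/2" N]) force+
qed

lemma Cauchy_nonarch_inverse:
  fixes S :: "nat \<Rightarrow> 'a :: nonarch_field"
  assumes "Cauchy S" "\<not> S \<longlonglongrightarrow> 0"
  shows "Cauchy (\<lambda>n. inverse (S n))"
  unfolding Cauchy_nonarch_iff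
proof (intro allI impI)
  fix e :: real assume "e > 0"
  obtain b N where b: "b > 0" "\<And>n. n \<ge> N \<Longrightarrow> vabs (S n) \<ge> b"
    using Cauchy_nonarch_not_null[OF assms] by blast
  obtain M where M: "\<And>m n. m \<ge> M \<Longrightarrow> n \<ge> M \<Longrightarrow> vabs (S m - S n) < e * (b * b)"
    using assms(1) \<open>e > 0\<close> b unfolding Cauchy_nonarch_iff by (metis mult_pos_pos)
  have "vabs (inverse (S m) - inverse (S n)) < e" if mn: "m \<ge> max M N" "n \<ge> max M N" for m n
  proof -
    have bm: "vabs (S m) \<ge> b" "vabs (S n) \<ge> b" using b mn by auto
    hence nz: "S m \<noteq> 0" "S n \<noteq> 0" using b(1) by auto
    have "vabs (inverse (S m) - inverse (S n)) = vabs (S m - S n) / (vabs (S m) * vabs (S n))"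
      unfolding inverse_diff_inverse[OF nz] vabs_minus vabs_mult vabs_inverse
      by (simp add: field_simps)
    also have "\<dots> \<le> vabs (S m - S n) / (b * b)"
      using bm b(1) by (intro divide_left_mono mult_mono mult_pos_pos) (auto simp: vabs_nonneg)
    also have "\<dots> < e"
      using M[of m n] mn b(1) by (simp add: field_simps)
    finally show ?thesis .
  qed
  thus "\<exists>N. \<forall>m\<ge>N. \<forall>n\<ge>N. vabs (inverse (S m) - inverse (S n)) < e"
    by blast
qed

lemma null_seq_inverse_mult:
  fixes S :: "nat \<Rightarrow> 'a :: nonarch_field"
  assumes "Cauchy S" "\<not> S \<longlonglongrightarrow> 0"
  shows "(\<lambda>n. inverse (S n) * S n - 1) \<longlonglongrightarrow> 0"
proof -
  obtain b N where b: "b > 0" "\<And>n. n \<ge> N \<Longrightarrow> vabs (S n) \<ge> b"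
    using Cauchy_nonarch_not_null[OF assms] by blast
  have "eventually (\<lambda>n. inverse (S n) * S n - 1 = 0) sequentially"
    using eventually_ge_at_top[of N]
  proof eventually_elim
    case (elim n)
    hence "S n \<noteq> 0" using b(1) b(2)[of n] by auto
    thus ?case by simp
  qed
  thus ?thesis by (rule tendsto_eventually)
qed

definition cauchy_rel :: "(nat \<Rightarrow> 'a :: nonarch_field) \<Rightarrow> (nat \<Rightarrow> 'a) \<Rightarrow> bool" where
  "cauchy_rel S T \<longleftrightarrow> Cauchy S \<and> Cauchy T \<and> (\<lambda>n. S n - T n) \<longlonglongrightarrow> 0"

lemma Cauchy_nonarch_const [simp]: "Cauchy (\<lambda>n. c :: 'a :: nonarch_field)"
  by (simp add: Cauchy_def)

lemma cauchy_rel_refl: "Cauchy S \<Longrightarrow> cauchy_rel S S"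
  by (simp add: cauchy_rel_def)

lemma part_equivp_cauchy_rel: "part_equivp (cauchy_rel :: (nat \<Rightarrow> 'a :: nonarch_field) \<Rightarrow> _)"
proof (rule part_equivpI)
  show "\<exists>S :: nat \<Rightarrow> 'a. cauchy_rel S S"
    by (rule exI[of _ "\<lambda>_. 0"]) (simp add: cauchy_rel_def)
  show "symp (cauchy_rel :: (nat \<Rightarrow> 'a) \<Rightarrow> _)"
  proof (rule sympI)
    fix S T :: "nat \<Rightarrow> 'a"
    have "(\<lambda>n. vabs (S n - T n)) = (\<lambda>n. vabs (T n - S n))"
      by (rule ext) (rule vabs_minus_commute)
    thus "cauchy_rel S T \<Longrightarrow> cauchy_rel T S"
      by (simp add: cauchy_rel_def null_seq_iff)
  qed
  show "transp (cauchy_rel :: (nat \<Rightarrow> 'a) \<Rightarrow> _)"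
    unfolding transp_def cauchy_rel_def
  proof safe
    fix S T U :: "nat \<Rightarrow> 'a"
    assume "(\<lambda>n. S n - T n) \<longlonglongrightarrow> 0" "(\<lambda>n. T n - U n) \<longlonglongrightarrow> 0"
    from null_seq_add[OF this] show "(\<lambda>n. S n - U n) \<longlonglongrightarrow> 0" by simp
  qed
qed

quotient_type (overloaded) 'a completion = "nat \<Rightarrow> 'a :: nonarch_field" / partial: cauchy_rel
  by (rule part_equivp_cauchy_rel)

lemma Domainp_pcr_completion [transfer_domain_rule]:
  "Domainp (pcr_completion (=)) = Cauchy"
  by (auto simp: fun_eq_iff completion.domain_eq cauchy_rel_def)

instantiation completion :: (nonarch_field) field
begin

lift_definition zero_completion :: "'a completion" is "\<lambda>_. 0"
  by (simp add: cauchy_rel_refl)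

lift_definition one_completion :: "'a completion" is "\<lambda>_. 1"
  by (simp add: cauchy_rel_refl)

lift_definition plus_completion :: "'a completion \<Rightarrow> 'a completion \<Rightarrow> 'a completion"
  is "\<lambda>S T n. S n + T n"
  unfolding cauchy_rel_def add_diff_add by (simp add: Cauchy_nonarch_add null_seq_add)

lift_definition uminus_completion :: "'a completion \<Rightarrow> 'a completion"
  is "\<lambda>S n. - S n"
proof -
  fix S T :: "nat \<Rightarrow> 'a"
  assume "cauchy_rel S T"
  thus "cauchy_rel (\<lambda>n. - S n) (\<lambda>n. - T n)"
    using null_seq_minus[of "\<lambda>n. S n - T n"]
    unfolding cauchy_rel_def minus_diff_minus by (intro conjI Cauchy_nonarch_minus) auto
qed

lift_definition minus_completion :: "'a completion \<Rightarrow> 'a completion \<Rightarrow> 'a completion"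
  is "\<lambda>S T n. S n - T n"
proof -
  fix S S' T T' :: "nat \<Rightarrow> 'a"
  assume *: "cauchy_rel S S'" "cauchy_rel T T'"
  have "(\<lambda>n. (S n - S' n) - (T n - T' n)) \<longlonglongrightarrow> 0"
    using * by (intro null_seq_diff[of "\<lambda>n. S n - S' n"]) (auto simp: cauchy_rel_def)
  thus "cauchy_rel (\<lambda>n. S n - T n) (\<lambda>n. S' n - T' n)"
    using * by (simp add: cauchy_rel_def Cauchy_nonarch_diff algebra_simps)
qed

lift_definition times_completion :: "'a completion \<Rightarrow> 'a completion \<Rightarrow> 'a completion"
  is "\<lambda>S T n. S n * T n"
proof -
  fix S S' T T' :: "nat \<Rightarrow> 'a"
  assume *: "cauchy_rel S S'" "cauchy_rel T T'"
  obtain A where A: "\<And>n. vabs (S n) \<le> A"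
    using Cauchy_nonarch_bounded * unfolding cauchy_rel_def by meson
  obtain B where B: "\<And>n. vabs (T' n) \<le> B"
    using Cauchy_nonarch_bounded * unfolding cauchy_rel_def by meson
  have "(\<lambda>n. S n * (T n - T' n) + T' n * (S n - S' n)) \<longlonglongrightarrow> 0"
    using * A B by (intro null_seq_add null_seq_mult_Bseq) (auto simp: cauchy_rel_def)
  thus "cauchy_rel (\<lambda>n. S n * T n) (\<lambda>n. S' n * T' n)"
    using * by (simp add: cauchy_rel_def Cauchy_nonarch_mult algebra_simps)
qed

lift_definition inverse_completion :: "'a completion \<Rightarrow> 'a completion"
  is "\<lambda>S. if S \<longlonglongrightarrow> 0 then (\<lambda>_. 0) else (\<lambda>n. inverse (S n))"
proof -
  fix S T :: "nat \<Rightarrow> 'a"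
  assume *: "cauchy_rel S T"
  hence S: "Cauchy S" and T: "Cauchy T" and XY: "(\<lambda>n. S n - T n) \<longlonglongrightarrow> 0"
    by (auto simp: cauchy_rel_def)
  have iff: "S \<longlonglongrightarrow> 0 \<longleftrightarrow> T \<longlonglongrightarrow> 0"
    using null_seq_diff[OF _ XY, of S] null_seq_add[OF XY, of T] by auto
  show "cauchy_rel (if S \<longlonglongrightarrow> 0 then (\<lambda>_. 0) else (\<lambda>n. inverse (S n)))
          (if T \<longlonglongrightarrow> 0 then (\<lambda>_. 0) else (\<lambda>n. inverse (T n)))"
  proof (cases "S \<longlonglongrightarrow> 0")
    case True
    thus ?thesis using iff by (simp add: cauchy_rel_def)
  next
    case False
    hence nX: "\<not> S \<longlonglongrightarrow> 0" and nY: "\<not> T \<longlonglongrightarrow> 0" using iff by auto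
    obtain B where B: "\<And>n. vabs (inverse (S n)) \<le> B"
      using Cauchy_nonarch_bounded[OF Cauchy_nonarch_inverse[OF S nX]] by blast
    obtain C where C: "\<And>n. vabs (inverse (T n)) \<le> C"
      using Cauchy_nonarch_bounded[OF Cauchy_nonarch_inverse[OF T nY]] by blast
    have "(\<lambda>n. inverse (S n) * (inverse (T n) * (S n - T n))) \<longlonglongrightarrow> 0"
      by (intro null_seq_mult_Bseq[OF B] null_seq_mult_Bseq[OF C] XY)
    hence 1: "(\<lambda>n. - (inverse (S n) * (inverse (T n) * (S n - T n)))) \<longlonglongrightarrow> 0"
      by (simp only: null_seq_minus)
    obtain b N where b: "b > 0" "\<And>n. n \<ge> N \<Longrightarrow> vabs (S n) \<ge> b"
      using Cauchy_nonarch_not_null[OF S nX] by blast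
    obtain c M where c: "c > 0" "\<And>n. n \<ge> M \<Longrightarrow> vabs (T n) \<ge> c"
      using Cauchy_nonarch_not_null[OF T nY] by blast
    have "eventually (\<lambda>n. - (inverse (S n) * (inverse (T n) * (S n - T n))) =
            inverse (S n) - inverse (T n)) sequentially"
      using eventually_ge_at_top[of "max M N"]
    proof eventually_elim
      case (elim n)
      hence "S n \<noteq> 0" "T n \<noteq> 0" using b(1) b(2)[of n] c(1) c(2)[of n] by auto
      thus ?case by (simp add: field_simps)
    qed
    from tendsto_cong[OF this] 1 have "(\<lambda>n. inverse (S n) - inverse (T n)) \<longlonglongrightarrow> 0"
      by simp
    thus ?thesis
      using nX nY S T by (simp add: cauchy_rel_def Cauchy_nonarch_inverse)
  qed
qed

definition divide_completion :: "'a completion \<Rightarrow> 'a completion \<Rightarrow> 'a completion" where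
  "divide_completion x y = x * inverse y"

instance
proof
  fix a b c :: "'a completion"
  show "a + b = b + a"
    by transfer (simp add: ac_simps cauchy_rel_def Cauchy_nonarch_add)
  show "(a + b) + c = a + (b + c)"
    by transfer (simp add: ac_simps cauchy_rel_def Cauchy_nonarch_add)
  show "0 + a = a"
    by transfer (simp add: cauchy_rel_def)
  show "- a + a = 0"
    by transfer (simp add: cauchy_rel_def)
  show "a - b = a + - b"
    by transfer (simp add: cauchy_rel_def Cauchy_nonarch_diff)
  show "(a * b) * c = a * (b * c)"
    by transfer (simp add: ac_simps cauchy_rel_def Cauchy_nonarch_mult)
  show "a * b = b * a"
    by transfer (simp add: ac_simps cauchy_rel_def Cauchy_nonarch_mult)
  show "1 * a = a"
    by transfer (simp add: cauchy_rel_def)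
  show "(a + b) * c = a * c + b * c"
    by transfer (simp add: distrib_right cauchy_rel_def Cauchy_nonarch_mult Cauchy_nonarch_add)
  show "(0::'a completion) \<noteq> 1"
  proof (transfer, rule notI)
    assume "cauchy_rel (\<lambda>_. 0 :: 'a) (\<lambda>_. 1)"
    hence "(\<lambda>_::nat. 1 :: real) \<longlonglongrightarrow> 0"
      by (simp add: cauchy_rel_def null_seq_iff)
    thus False by (simp add: LIMSEQ_const_iff)
  qed
  show "a \<noteq> 0 \<Longrightarrow> inverse a * a = 1"
  proof transfer
    fix S :: "nat \<Rightarrow> 'a"
    assume S: "Cauchy S" "\<not> cauchy_rel S (\<lambda>_. 0)"
    hence "\<not> S \<longlonglongrightarrow> 0" by (simp add: cauchy_rel_def)
    with S(1) show "cauchy_rel (\<lambda>n. (if S \<longlonglongrightarrow> 0 then \<lambda>_. 0 else (\<lambda>n. inverse (S n))) n * S n) (\<lambda>_. 1)"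
      by (simp add: cauchy_rel_def null_seq_inverse_mult Cauchy_nonarch_mult Cauchy_nonarch_inverse)
  qed
  show "a div b = a * inverse b"
    by (rule divide_completion_def)
  show "inverse (0::'a completion) = 0"
    by transfer (simp add: cauchy_rel_def)
qed

end

lift_definition to_completion :: "'a :: nonarch_field \<Rightarrow> 'a completion" is "\<lambda>x _. x"
  by (simp add: cauchy_rel_refl)

lemma to_completion_eq_iff [simp]: "to_completion x = to_completion y \<longleftrightarrow> x = y"
  by transfer (auto simp: cauchy_rel_def tendsto_const_iff)

lemma to_completion_0 [simp]: "to_completion 0 = 0"
  and to_completion_1 [simp]: "to_completion 1 = 1"
  and to_completion_add [simp]: "to_completion (x + y) = to_completion x + to_completion y"
  and to_completion_mult [simp]: "to_completion (x * y) = to_completion x * to_completion y"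
  and to_completion_minus [simp]: "to_completion (- x) = - to_completion x"
  and to_completion_diff [simp]: "to_completion (x - y) = to_completion x - to_completion y"
  by (transfer; simp add: cauchy_rel_def)+

lemma to_completion_of_nat [simp]: "to_completion (of_nat n) = of_nat n"
  by (induction n) auto

instance completion :: (nonarch_field) field_char_0
proof
  show "inj (of_nat :: nat \<Rightarrow> 'a completion)"
    by (rule injI) (metis of_nat_eq_iff to_completion_eq_iff to_completion_of_nat)
qed

lemma vabs_seq_tendsto:
  fixes S :: "nat \<Rightarrow> 'a :: nonarch_field"
  assumes "Cauchy S"
  shows "(\<lambda>n. vabs (S n)) \<longlonglongrightarrow> lim (\<lambda>n. vabs (S n))"
  using Cauchy_vabs[OF assms] by (simp add: Cauchy_convergent_iff convergent_LIMSEQ_iff)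

lift_definition completion_vabs :: "'a :: nonarch_field completion \<Rightarrow> real"
  is "\<lambda>S. lim (\<lambda>n. vabs (S n))"
proof -
  fix S T :: "nat \<Rightarrow> 'a"
  assume *: "cauchy_rel S T"
  have 0: "(\<lambda>n. vabs (S n - T n)) \<longlonglongrightarrow> 0"
    using * by (auto simp: cauchy_rel_def null_seq_iff)
  have "(\<lambda>n. \<bar>vabs (S n) - vabs (T n)\<bar>) \<longlonglongrightarrow> 0"
    by (rule tendsto_sandwich[OF _ _ tendsto_const 0])
       (intro always_eventually allI abs_ge_zero vabs_diff_vabs)+
  hence "(\<lambda>n. vabs (S n) - vabs (T n)) \<longlonglongrightarrow> 0"
    by (rule tendsto_rabs_zero_cancel)
  moreover have "(\<lambda>n. vabs (S n) - vabs (T n)) \<longlonglongrightarrow>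
      lim (\<lambda>n. vabs (S n)) - lim (\<lambda>n. vabs (T n))"
    using * by (intro tendsto_diff vabs_seq_tendsto) (auto simp: cauchy_rel_def)
  ultimately have "0 = lim (\<lambda>n. vabs (S n)) - lim (\<lambda>n. vabs (T n))"
    by (rule LIMSEQ_unique)
  thus "lim (\<lambda>n. vabs (S n)) = lim (\<lambda>n. vabs (T n))" by simp
qed

lemma completion_vabs_eq_0: "completion_vabs x = 0 \<longleftrightarrow> x = 0"
proof transfer
  fix S :: "nat \<Rightarrow> 'a" assume "Cauchy S"
  have "lim (\<lambda>n. vabs (S n)) = 0 \<longleftrightarrow> (\<lambda>n. vabs (S n)) \<longlonglongrightarrow> 0"
    using vabs_seq_tendsto[OF \<open>Cauchy S\<close>] limI by metis
  thus "lim (\<lambda>n. vabs (S n)) = 0 \<longleftrightarrow> cauchy_rel S (\<lambda>_. 0)"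
    using \<open>Cauchy S\<close> by (simp add: cauchy_rel_def null_seq_iff)
qed

lemma completion_vabs_mult: "completion_vabs (x * y) = completion_vabs x * completion_vabs y"
proof transfer
  fix S T :: "nat \<Rightarrow> 'a" assume *: "Cauchy S" "Cauchy T"
  show "lim (\<lambda>n. vabs (S n * T n)) = lim (\<lambda>n. vabs (S n)) * lim (\<lambda>n. vabs (T n))"
    unfolding vabs_mult by (intro limI tendsto_mult vabs_seq_tendsto *)
qed

lemma completion_vabs_add:
  "completion_vabs (x + y) \<le> max (completion_vabs x) (completion_vabs y)"
proof transfer
  fix S T :: "nat \<Rightarrow> 'a" assume *: "Cauchy S" "Cauchy T"
  show "lim (\<lambda>n. vabs (S n + T n)) \<le> max (lim (\<lambda>n. vabs (S n))) (lim (\<lambda>n. vabs (T n)))"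
    by (rule LIMSEQ_le[OF vabs_seq_tendsto[OF Cauchy_nonarch_add[OF *]]
          tendsto_max[OF vabs_seq_tendsto[OF *(1)] vabs_seq_tendsto[OF *(2)]]])
       (auto intro: vabs_add)
qed

lemma completion_vabs_nonneg: "completion_vabs x \<ge> 0"
proof transfer
  fix S :: "nat \<Rightarrow> 'a" assume "Cauchy S"
  from vabs_seq_tendsto[OF this] show "0 \<le> lim (\<lambda>n. vabs (S n))"
    by (rule LIMSEQ_le_const) (auto simp: vabs_nonneg)
qed

lemma nonarch_metricI:
  fixes N :: "'a :: field \<Rightarrow> real"
  assumes "\<And>x. N x \<ge> 0" "\<And>x. N x = 0 \<longleftrightarrow> x = 0" "\<And>x y. N (x * y) = N x * N y"
    "\<And>x y. N (x + y) \<le> max (N x) (N y)"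
  shows "N (x - y) = 0 \<longleftrightarrow> x = y" "N (x - y) \<le> N (x - z) + N (y - z)"
proof -
  show "N (x - y) = 0 \<longleftrightarrow> x = y"
    by (simp add: assms(2))
  have "N 1 * N 1 = N 1" "N (-1) * N (-1) = N 1"
    by (simp_all flip: assms(3))
  moreover have "N 1 \<noteq> 0" by (simp add: assms(2))
  ultimately have "N (-1) = 1"
    using assms(1)[of "-1"] by (simp add: square_eq_1_iff)
  hence "N (z - y) = N (y - z)"
    using assms(3)[of "-1" "y - z"] by simp
  moreover have "N (x - y) \<le> max (N (x - z)) (N (z - y))"
    using assms(4)[of "x - z" "z - y"] by simp
  ultimately show "N (x - y) \<le> N (x - z) + N (y - z)"
    using assms(1)[of "x - z"] assms(1)[of "y - z"] by linarith
qed

lemmas completion_metric = nonarch_metricI[where N = completion_vabs, OF completion_vabs_nonneg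
  completion_vabs_eq_0 completion_vabs_mult completion_vabs_add]

instantiation completion :: (nonarch_field) metric_space
begin

definition dist_completion :: "'a completion \<Rightarrow> 'a completion \<Rightarrow> real" where
  "dist_completion x y = completion_vabs (x - y)"

definition uniformity_completion :: "('a completion \<times> 'a completion) filter" where
  "uniformity_completion = (INF e\<in>{0<..}. principal {(x, y). dist x y < e})"

definition open_completion :: "'a completion set \<Rightarrow> bool" where
  "open_completion U \<longleftrightarrow> (\<forall>x\<in>U. eventually (\<lambda>(x', y). x' = x \<longrightarrow> y \<in> U) uniformity)"

instance
  by standard
     (simp_all add: dist_completion_def uniformity_completion_def open_completion_def
        completion_metric)

end

instantiation completion :: (nonarch_field) nonarch_field
begin

definition vabs_completion :: "'a completion \<Rightarrow> real" where
  "vabs_completion = completion_vabs"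

instance
  by standard (simp_all add: dist_completion_def vabs_completion_def
    completion_vabs_mult completion_vabs_add)

end

lemma vabs_to_completion [simp]: "vabs (to_completion x) = vabs x"
  unfolding vabs_completion_def by transfer (simp add: limI)

lemma to_completion_dense:
  fixes x :: "'a :: nonarch_field completion"
  assumes "e > 0"
  obtains y where "dist x (to_completion y) < e"
proof -
  have "\<exists>y. completion_vabs (x - to_completion y) < e"
  proof (transfer fixing: e)
    fix S :: "nat \<Rightarrow> 'a" assume S: "Cauchy S"
    then obtain N where N: "\<And>m n. m \<ge> N \<Longrightarrow> n \<ge> N \<Longrightarrow> vabs (S m - S n) < e / 2"
      using \<open>e > 0\<close> unfolding Cauchy_nonarch_iff by (meson half_gt_zero)
    have "lim (\<lambda>n. vabs (S n - S N)) \<le> e / 2"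
      by (rule LIMSEQ_le_const2[OF vabs_seq_tendsto[OF Cauchy_nonarch_diff[OF S Cauchy_nonarch_const]]])
         (use N in \<open>auto intro!: exI[of _ N] less_imp_le\<close>)
    thus "\<exists>y. lim (\<lambda>n. vabs (S n - y)) < e"
      using \<open>e > 0\<close> by (intro exI[of _ "S N"]) auto
  qed
  thus ?thesis using that by (auto simp: dist_completion_def)
qed

lemma to_completion_limit:
  fixes S :: "nat \<Rightarrow> 'a :: nonarch_field"
  assumes "Cauchy S"
  shows "\<exists>x. (\<lambda>n. to_completion (S n)) \<longlonglongrightarrow> x"
proof -
  define x where "x = abs_completion S"
  have S: "cauchy_rel S S" using assms by (rule cauchy_rel_refl)
  have "(\<lambda>n. to_completion (S n)) \<longlonglongrightarrow> x"
  proof (rule metric_LIMSEQ_I)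
    fix e :: real assume "e > 0"
    then obtain N where N: "\<And>m n. m \<ge> N \<Longrightarrow> n \<ge> N \<Longrightarrow> vabs (S m - S n) < e / 2"
      using assms unfolding Cauchy_nonarch_iff by (meson half_gt_zero)
    have "dist (to_completion (S n)) x < e" if n: "n \<ge> N" for n
    proof -
      have "dist (to_completion (S n)) x = completion_vabs (abs_completion (\<lambda>m. S n - S m))"
        unfolding dist_completion_def x_def
        unfolding to_completion.abs_eq
        by (subst minus_completion.abs_eq) (auto simp: S cauchy_rel_refl)
      also have "\<dots> = lim (\<lambda>m. vabs (S n - S m))"
        by (subst completion_vabs.abs_eq)
           (auto intro!: cauchy_rel_refl Cauchy_nonarch_diff assms)
      also have "\<dots> \<le> e / 2"
        by (rule LIMSEQ_le_const2[OF vabs_seq_tendsto[OF Cauchy_nonarch_diff[OF Cauchy_nonarch_const assms]]])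
           (use N n in \<open>auto intro!: exI[of _ N] less_imp_le\<close>)
      finally show ?thesis using \<open>e > 0\<close> by simp
    qed
    thus "\<exists>N. \<forall>n\<ge>N. dist (to_completion (S n)) x < e" by blast
  qed
  thus ?thesis ..
qed

instance completion :: (nonarch_field) complete_space
proof
  fix x :: "nat \<Rightarrow> 'a completion"
  assume x: "Cauchy x"
  have "\<exists>y. dist (x n) (to_completion y) < inverse (real (Suc n))" for n
    by (rule to_completion_dense[of "inverse (real (Suc n))" "x n"]) auto
  then obtain y where y: "\<And>n. dist (x n) (to_completion (y n)) < inverse (real (Suc n))"
    by metis
  have 0: "(\<lambda>n. dist (x n) (to_completion (y n))) \<longlonglongrightarrow> 0"
    by (rule tendsto_sandwich[OF _ _ tendsto_const LIMSEQ_inverse_real_of_nat])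
       (intro always_eventually allI zero_le_dist less_imp_le y)+
  have "Cauchy y"
    unfolding Cauchy_def
  proof (intro allI impI)
    fix e :: real assume "e > 0"
    hence e: "e / 3 > 0" by simp
    obtain M where M: "\<And>m n. m \<ge> M \<Longrightarrow> n \<ge> M \<Longrightarrow> dist (x m) (x n) < e / 3"
      using x e unfolding Cauchy_def by meson
    obtain N where N: "\<And>n. n \<ge> N \<Longrightarrow> dist (x n) (to_completion (y n)) < e / 3"
      using order_tendstoD(2)[OF 0 e] by (auto simp: eventually_at_top_linorder)
    have "dist (y m) (y n) < e" if "m \<ge> max M N" "n \<ge> max M N" for m n
    proof -
      have "dist (y m) (y n) = dist (to_completion (y m)) (to_completion (y n))"
        by (simp add: dist_vabs flip: to_completion_diff)
      also have "\<dots> \<le> dist (x m) (to_completion (y m)) + dist (x m) (x n) + dist (x n) (to_completion (y n))"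
        using dist_triangle[of "to_completion (y m)" "to_completion (y n)" "x m"]
          dist_triangle[of "x m" "to_completion (y n)" "x n"]
        by (simp add: dist_commute)
      also have "\<dots> < e" using M[of m n] N[of m] N[of n] that by auto
      finally show ?thesis .
    qed
    thus "\<exists>M. \<forall>m\<ge>M. \<forall>n\<ge>M. dist (y m) (y n) < e" by blast
  qed
  from to_completion_limit[OF this] obtain z where z: "(\<lambda>n. to_completion (y n)) \<longlonglongrightarrow> z"
    by (elim exE)
  have "(\<lambda>n. dist (x n) z) \<longlonglongrightarrow> 0"
  proof (rule tendsto_sandwich[OF _ _ tendsto_const])
    show "(\<lambda>n. dist (x n) (to_completion (y n)) + dist (to_completion (y n)) z) \<longlonglongrightarrow> 0"
      using tendsto_add[OF 0 tendsto_dist_iff[THEN iffD1, OF z]] by simp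
  qed (simp_all add: dist_triangle)
  thus "convergent x"
    unfolding convergent_def by (blast intro: tendsto_dist_iff[THEN iffD2])
qed

definition extends_vabs :: "('a :: nonarch_field alg_closure \<Rightarrow> real) \<Rightarrow> bool" where
  "extends_vabs N \<longleftrightarrow>
     (\<forall>x. N x \<ge> 0) \<and> (\<forall>x. N x = 0 \<longleftrightarrow> x = 0) \<and> (\<forall>x y. N (x * y) = N x * N y) \<and>
     (\<forall>x y. N (x + y) \<le> max (N x) (N y)) \<and> (\<forall>x. N (to_ac x) = vabs x)"

text \<open>
  An extension exists by Chevalley's argument: among the subrings of the algebraic closure that
  meet the base field exactly in its valuation ring, a maximal one is a valuation ring, and it
  determines the extended absolute value because every \<open>x \<noteq> 0\<close> has a power in the base field up to
  a unit of that ring.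
\<close>

definition dom_ring :: "'a :: nonarch_field alg_closure set \<Rightarrow> bool" where
  "dom_ring A \<longleftrightarrow>
     (\<forall>x\<in>A. \<forall>y\<in>A. x + y \<in> A) \<and> (\<forall>x\<in>A. \<forall>y\<in>A. x * y \<in> A) \<and>
     (\<forall>x. to_ac x \<in> A \<longleftrightarrow> vabs x \<le> 1)"

lemma dom_ring_base: "dom_ring (to_ac ` {x. vabs x \<le> 1})"
  unfolding dom_ring_def
proof (intro conjI ballI allI)
  fix x y assume "x \<in> to_ac ` {x :: 'a. vabs x \<le> 1}" "y \<in> to_ac ` {x :: 'a. vabs x \<le> 1}"
  then obtain a b :: 'a where ab: "x = to_ac a" "y = to_ac b" "vabs a \<le> 1" "vabs b \<le> 1"
    by auto
  have "vabs (a + b) \<le> 1" using vabs_add[of a b] ab by linarith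
  thus "x + y \<in> to_ac ` {x. vabs x \<le> 1}"
    using ab by (intro image_eqI[of _ _ "a + b"]) auto
  have "vabs (a * b) \<le> 1" using ab by (simp add: vabs_mult vabs_nonneg mult_le_one)
  thus "x * y \<in> to_ac ` {x. vabs x \<le> 1}"
    using ab by (intro image_eqI[of _ _ "a * b"]) auto
qed auto

lemma dom_ring_Union:
  assumes "C \<noteq> {}" "subset.chain {A. dom_ring A} C"
  shows "dom_ring (\<Union>C)"
proof -
  have C: "dom_ring V" if "V \<in> C" for V
    using assms that by (auto simp: subset_chain_def)
  have C2: "V \<subseteq> W \<or> W \<subseteq> V" if "V \<in> C" "W \<in> C" for V W
    using assms(2) that by (auto simp: subset_chain_def)
  have pair: "\<exists>V\<in>C. x \<in> V \<and> y \<in> V" if xy: "x \<in> \<Union>C" "y \<in> \<Union>C" for x y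
  proof -
    from xy obtain V W where "V \<in> C" "W \<in> C" "x \<in> V" "y \<in> W" by blast
    with C2[of V W] show ?thesis by blast
  qed
  show ?thesis
    unfolding dom_ring_def
  proof (intro conjI ballI allI)
    fix x y assume xy: "x \<in> \<Union>C" "y \<in> \<Union>C"
    obtain V where V: "V \<in> C" "x \<in> V" "y \<in> V"
      using pair[OF xy] by blast
    show "x + y \<in> \<Union>C" "x * y \<in> \<Union>C"
      using V C[OF V(1)] unfolding dom_ring_def by blast+
  next
    fix x
    obtain V where "V \<in> C" using assms(1) by blast
    with C show "to_ac x \<in> \<Union>C \<longleftrightarrow> vabs x \<le> 1"
      unfolding dom_ring_def by blast
  qed
qed

locale max_dom_ring =
  fixes A :: "'a :: nonarch_field alg_closure set"
  assumes dom: "dom_ring A"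
    and maximal: "\<And>B. dom_ring B \<Longrightarrow> A \<subseteq> B \<Longrightarrow> B = A"
begin

lemma add_closed: "x \<in> A \<Longrightarrow> y \<in> A \<Longrightarrow> x + y \<in> A"
  and mult_closed: "x \<in> A \<Longrightarrow> y \<in> A \<Longrightarrow> x * y \<in> A"
  and to_ac_iff: "to_ac z \<in> A \<longleftrightarrow> vabs z \<le> 1"
  using dom unfolding dom_ring_def by blast+

lemma zero_closed: "0 \<in> A"
  using to_ac_iff[of 0] by simp

lemma one_closed: "1 \<in> A"
  using to_ac_iff[of 1] by simp

lemma minus_closed: "x \<in> A \<Longrightarrow> - x \<in> A"
  using mult_closed[of "to_ac (-1)" x] to_ac_iff[of "-1"] by simp

lemma power_closed: "x \<in> A \<Longrightarrow> x ^ n \<in> A"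
  by (induction n) (auto intro: one_closed mult_closed)

lemma sum_closed: "(\<And>i. i \<in> I \<Longrightarrow> f i \<in> A) \<Longrightarrow> sum f I \<in> A"
  by (induction I rule: infinite_finite_induct) (auto intro: zero_closed add_closed)

definition M :: "'a alg_closure set" where
  "M = {to_ac c * a | c a. vabs c < 1 \<and> a \<in> A}"

lemma M_subset: "M \<subseteq> A"
  unfolding M_def by (auto intro!: mult_closed simp: to_ac_iff)

lemma zero_M: "0 \<in> M"
  unfolding M_def using zero_closed by (auto intro!: exI[of _ 0])

lemma mult_M: "m \<in> M \<Longrightarrow> a \<in> A \<Longrightarrow> m * a \<in> M"
  unfolding M_def by (force simp: mult.assoc intro: mult_closed)

lemma one_notin_M: "1 \<notin> M"
proof
  assume "1 \<in> M"
  then obtain c a where ca: "1 = to_ac c * a" "vabs c < 1" "a \<in> A"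
    unfolding M_def by blast
  hence "c \<noteq> 0" by auto
  hence "to_ac (inverse c) = a"
    using ca(1) by (simp add: inverse_unique)
  hence "vabs (inverse c) \<le> 1"
    using ca(3) to_ac_iff[of "inverse c"] by simp
  with ca(2) \<open>c \<noteq> 0\<close> show False
    using vabs_eq_0[of c] vabs_nonneg[of c] by (simp add: vabs_inverse inverse_le_1_iff)
qed

lemma add_M:
  assumes "x \<in> M" "y \<in> M"
  shows "x + y \<in> M"
proof -
  have *: "to_ac c * a + to_ac d * b \<in> M"
    if "vabs c < 1" "vabs d \<le> vabs c" "a \<in> A" "b \<in> A" for c d a b
  proof (cases "c = 0")
    case True
    with that have "d = 0" using vabs_nonneg[of d] by (simp add: vabs_eq_0)
    thus ?thesis using True zero_M by simp
  next
    case False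
    hence "vabs c > 0" using vabs_eq_0[of c] vabs_nonneg[of c] by simp
    hence "vabs (d / c) \<le> 1" using that by (simp add: vabs_divide)
    hence "a + to_ac (d / c) * b \<in> A"
      using that by (intro add_closed mult_closed) (auto simp: to_ac_iff simp del: to_ac_divide)
    moreover have "to_ac c * a + to_ac d * b = to_ac c * (a + to_ac (d / c) * b)"
      using False by (simp add: algebra_simps)
    ultimately show ?thesis
      using that unfolding M_def by blast
  qed
  obtain c a where x: "x = to_ac c * a" "vabs c < 1" "a \<in> A"
    using assms(1) unfolding M_def by blast
  obtain d b where y: "y = to_ac d * b" "vabs d < 1" "b \<in> A"
    using assms(2) unfolding M_def by blast
  show ?thesis
    using *[of c d a b] *[of d c b a] x y by (cases "vabs d \<le> vabs c") (auto simp: add.commute)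
qed

lemma minus_M: "x \<in> M \<Longrightarrow> - x \<in> M"
  using mult_M[of x "-1"] minus_closed[OF one_closed] by simp

lemma sum_M: "(\<And>i. i \<in> I \<Longrightarrow> f i \<in> M) \<Longrightarrow> sum f I \<in> M"
  by (induction I rule: infinite_finite_induct) (auto intro: zero_M add_M)

lemma adjoin:
  assumes "x \<notin> A"
  obtains q where "\<And>i. coeff q i \<in> M" "poly q x = 1"
proof -
  define B where "B = {poly q x | q. \<forall>i. coeff q i \<in> A}"
  have "A \<subseteq> B"
  proof
    fix a assume "a \<in> A"
    hence "poly [:a:] x = a" "\<forall>i. coeff [:a:] i \<in> A"
      by (auto simp: coeff_pCons zero_closed split: nat.splits)
    thus "a \<in> B" unfolding B_def by force
  qed
  have "x \<in> B"
  proof -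
    have "poly [:0, 1:] x = x" "\<forall>i. coeff [:0, 1:] i \<in> A"
      by (auto simp: coeff_pCons zero_closed one_closed split: nat.splits)
    thus ?thesis unfolding B_def by (intro CollectI exI[of _ "[:0, 1:]"]) simp
  qed
  have add: "y + z \<in> B" if yz: "y \<in> B" "z \<in> B" for y z
  proof -
    obtain q r where qr: "y = poly q x" "z = poly r x" "\<forall>i. coeff q i \<in> A" "\<forall>i. coeff r i \<in> A"
      using yz unfolding B_def by blast
    have "y + z = poly (q + r) x" "\<forall>i. coeff (q + r) i \<in> A"
      using qr by (auto intro: add_closed)
    thus ?thesis unfolding B_def by blast
  qed
  have mult: "y * z \<in> B" if yz: "y \<in> B" "z \<in> B" for y z
  proof -
    obtain q r where qr: "y = poly q x" "z = poly r x" "\<forall>i. coeff q i \<in> A" "\<forall>i. coeff r i \<in> A"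
      using yz unfolding B_def by blast
    have "y * z = poly (q * r) x" "\<forall>i. coeff (q * r) i \<in> A"
      using qr by (auto simp: coeff_mult intro!: sum_closed mult_closed)
    thus ?thesis unfolding B_def by blast
  qed
  have "\<not> dom_ring B"
    using maximal[of B] \<open>A \<subseteq> B\<close> \<open>x \<in> B\<close> assms by blast
  then obtain d where d: "to_ac d \<in> B" "\<not> vabs d \<le> 1"
    using add mult \<open>A \<subseteq> B\<close> to_ac_iff unfolding dom_ring_def by blast
  then obtain q where q: "to_ac d = poly q x" "\<forall>i. coeff q i \<in> A"
    unfolding B_def by blast
  show ?thesis
  proof (rule that[of "smult (to_ac (inverse d)) q"])
    have "d \<noteq> 0" using d(2) by auto
    have "vabs (inverse d) < 1"
      using d(2) by (simp add: vabs_inverse inverse_less_1_iff)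
    thus "coeff (smult (to_ac (inverse d)) q) i \<in> M" for i
      using q(2) unfolding M_def coeff_smult by blast
    show "poly (smult (to_ac (inverse d)) q) x = 1"
      using \<open>d \<noteq> 0\<close> q(1) by (simp flip: q(1))
  qed
qed

lemma power_one_minus_M: "m \<in> M \<Longrightarrow> \<exists>m'\<in>M. (1 - m) ^ n = 1 - m'"
proof (induction n)
  case 0
  thus ?case using zero_M by (intro bexI[of _ 0]) auto
next
  case (Suc n)
  then obtain m' where m': "m' \<in> M" "(1 - m) ^ n = 1 - m'" by blast
  have "(1 - m) ^ Suc n = (1 - m) * (1 - m')"
    by (simp add: m'(2))
  also have "\<dots> = 1 - (m + m' * (1 - m))"
    by (simp add: algebra_simps)
  finally have "(1 - m) ^ Suc n = 1 - (m + m' * (1 - m))" .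
  moreover have "1 - m \<in> A"
    using add_closed[OF one_closed minus_closed[of m]] M_subset Suc.prems by auto
  ultimately show ?case
    using m' Suc.prems by (intro bexI[of _ "m + m' * (1 - m)"] add_M mult_M) auto
qed

lemma one_minus_M:
  assumes "m \<in> M"
  shows "1 - m \<noteq> 0" "inverse (1 - m) \<in> A"
proof -
  define s where "s = 1 - m"
  have s: "s \<in> A"
    using add_closed[OF one_closed minus_closed[of m]] M_subset assms by (auto simp: s_def)
  show s0: "1 - m \<noteq> 0" using assms one_notin_M by auto
  show "inverse (1 - m) \<in> A"
  proof (rule ccontr)
    assume "inverse (1 - m) \<notin> A"
    then obtain q where q: "\<And>i. coeff q i \<in> M" "poly q (inverse s) = 1"
      using adjoin unfolding s_def by blast
    have "s ^ degree q = s ^ degree q * poly q (inverse s)" by (simp add: q(2))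
    also have "\<dots> = (\<Sum>i\<le>degree q. coeff q i * s ^ (degree q - i))"
      unfolding poly_altdef sum_distrib_left
      using s0 by (intro sum.cong) (auto simp: s_def power_diff field_simps)
    also have "\<dots> \<in> M"
      by (intro sum_M mult_M q power_closed s)
    finally have 1: "s ^ degree q \<in> M" .
    obtain m' where m': "m' \<in> M" "s ^ degree q = 1 - m'"
      using power_one_minus_M[OF assms] unfolding s_def by blast
    have "s ^ degree q + m' \<in> M"
      using 1 m' by (intro add_M) auto
    thus False using m' one_notin_M by simp
  qed
qed

lemma valuation_step:
  assumes q: "\<And>i. coeff q i \<in> M" "poly q x = 1" "degree q \<le> Suc n"
    and r: "\<And>i. coeff r i \<in> M" "poly r (inverse x) = 1" "degree r \<le> Suc n"
    and x: "x \<noteq> 0"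
  obtains q' where "\<And>i. coeff q' i \<in> M" "poly q' x = 1" "degree q' \<le> n"
proof -
  define N where "N = Suc n"
  define u where "u = inverse (1 - coeff r 0)"
  have u: "u \<in> A" "(1 - coeff r 0) * u = 1"
    using one_minus_M[of "coeff r 0"] r(1)[of 0] by (auto simp: u_def)
  have A: "coeff r i \<in> A" "coeff q i \<in> A" for i
    using r(1) q(1) M_subset by blast+
  define t where "t = (\<Sum>j=1..N. monom (coeff r j) (N - j))"
  define q' where "q' = q - monom (coeff q N) N + smult (coeff q N * u) t"
  have "(\<Sum>j\<le>N. coeff r j * inverse x ^ j) = 1"
  proof -
    have "(\<Sum>j\<le>N. coeff r j * inverse x ^ j) = (\<Sum>j\<le>degree r. coeff r j * inverse x ^ j)"
      using r(3) by (intro sum.mono_neutral_right) (auto simp: N_def coeff_eq_0)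
    thus ?thesis using r(2) by (simp add: poly_altdef)
  qed
  hence "coeff r 0 + (\<Sum>j=1..N. coeff r j * inverse x ^ j) = 1"
  proof -
    have "{..N} = insert 0 {1..N}" by auto
    thus ?thesis using \<open>(\<Sum>j\<le>N. coeff r j * inverse x ^ j) = 1\<close> by simp
  qed
  hence "(\<Sum>j=1..N. coeff r j * inverse x ^ j) = 1 - coeff r 0"
    by (simp add: eq_diff_eq add.commute)
  hence "(\<Sum>j=1..N. coeff r j * inverse x ^ j) * x ^ N = (1 - coeff r 0) * x ^ N"
    by (rule arg_cong)
  also have "(\<Sum>j=1..N. coeff r j * inverse x ^ j) * x ^ N = poly t x"
    unfolding t_def poly_sum poly_monom sum_distrib_right
    using x by (intro sum.cong) (auto simp: power_diff field_simps)
  finally have t: "u * poly t x = x ^ N"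
    using u(2) by (simp add: mult.assoc [symmetric] mult.commute[of u])
  show ?thesis
  proof (rule that[of q'])
    have "coeff t i \<in> A" for i
      unfolding t_def coeff_sum by (intro sum_closed) (auto simp: A zero_closed)
    thus "coeff q' i \<in> M" for i
      unfolding q'_def using q(1)
      by (auto intro!: add_M mult_M mult_closed u zero_M simp: mult.assoc)
    show "poly q' x = 1"
      using t q(2) by (simp add: q'_def poly_monom mult.assoc)
    have "coeff q' i = 0" if "i > n" for i
    proof (cases "i = N")
      case True
      have "coeff t N = 0"
        unfolding t_def coeff_sum by (intro sum.neutral) (auto simp: N_def)
      thus ?thesis using True by (simp add: q'_def)
    next
      case False
      hence "i > N" using that by (simp add: N_def)
      hence "coeff t i = 0" "coeff q i = 0"
        unfolding t_def coeff_sum using q(3) by (auto intro!: sum.neutral coeff_eq_0 simp: N_def)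
      thus ?thesis using False by (simp add: q'_def)
    qed
    thus "degree q' \<le> n" by (intro degree_le) auto
  qed
qed

lemma valuation_aux:
  assumes q: "\<And>i. coeff q i \<in> M" "poly q x = 1" "degree q \<le> n"
    and r: "\<And>i. coeff r i \<in> M" "poly r (inverse x) = 1" "degree r \<le> k"
    and x: "x \<noteq> 0"
  shows False
  using assms
proof (induction "n + k" arbitrary: n k q r x rule: less_induct)
  case (less n k q r x)
  have nz: "m \<noteq> 0" if "\<And>i. coeff p i \<in> M" "poly p y = 1" "degree p \<le> m" for p m and y
  proof
    assume "m = 0"
    with that obtain c where "p = [:c:]" by (metis degree_eq_zeroE le_zero_eq)
    with that(1)[of 0] that(2) one_notin_M show False by simp
  qed
  obtain n' where n': "n = Suc n'"
    using nz[OF less.prems(1-3)] by (cases n) auto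
  obtain k' where k': "k = Suc k'"
    using nz[OF less.prems(4-6)] by (cases k) auto
  show False
  proof (cases "k \<le> n")
    case True
    obtain q' where q': "\<And>i. coeff q' i \<in> M" "poly q' x = 1" "degree q' \<le> n'"
      using valuation_step[of q x n' r] less.prems True n' by (metis le_trans)
    show False
      using less.hyps[of n' k q' x r] q' less.prems n' by simp
  next
    case False
    hence nk: "degree q \<le> Suc k'"
      using less.prems k' by simp
    obtain r' where r': "\<And>i. coeff r' i \<in> M" "poly r' (inverse x) = 1" "degree r' \<le> k'"
      using valuation_step[of r "inverse x" k' q] less.prems nk k' by (metis inverse_inverse_eq inverse_nonzero_iff_nonzero)
    show False
      using less.hyps[of n k' q x r'] r' less.prems k' by simp
  qed
qed

lemma valuation_ring: "x \<in> A \<or> inverse x \<in> A"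
proof (rule ccontr)
  assume *: "\<not> (x \<in> A \<or> inverse x \<in> A)"
  hence "x \<noteq> 0" using zero_closed by auto
  obtain q where "\<And>i. coeff q i \<in> M" "poly q x = 1" using adjoin * by blast
  moreover obtain r where "\<And>i. coeff r i \<in> M" "poly r (inverse x) = 1" using adjoin * by blast
  ultimately show False using valuation_aux[of q x "degree q" r "degree r"] \<open>x \<noteq> 0\<close> by blast
qed

definition U :: "'a alg_closure set" where
  "U = {x. x \<noteq> 0 \<and> x \<in> A \<and> inverse x \<in> A}"

lemma one_U: "1 \<in> U"
  by (simp add: U_def one_closed)

lemma mult_U: "x \<in> U \<Longrightarrow> y \<in> U \<Longrightarrow> x * y \<in> U"
  by (auto simp: U_def mult_closed inverse_mult_distrib)

lemma inverse_U: "x \<in> U \<Longrightarrow> inverse x \<in> U"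
  by (auto simp: U_def)

lemma power_U: "x \<in> U \<Longrightarrow> x ^ n \<in> U"
  by (induction n) (auto intro: one_U mult_U)

lemma to_ac_U: "to_ac c \<in> U \<longleftrightarrow> vabs c = 1"
  unfolding U_def using to_ac_iff[of c] to_ac_iff[of "inverse c"] vabs_eq_0[of c] vabs_nonneg[of c]
  by (auto simp: vabs_inverse inverse_le_1_iff)

lemma nonunit_add:
  assumes "x \<in> A - U" "y \<in> A - U"
  shows "x + y \<in> A - U"
proof -
  have *: "x + y \<in> A - U" if xy: "x \<in> A - U" "y \<in> A - U" "x * inverse y \<in> A" for x y
  proof (cases "y = 0")
    case False
    have xy': "x + y \<in> A" using xy by (auto intro: add_closed)
    have "x + y \<notin> U"
    proof
      assume U: "x + y \<in> U"
      have "inverse y = (x * inverse y + 1) * inverse (x + y)"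
        using False U by (simp add: U_def field_simps)
      moreover have "(x * inverse y + 1) * inverse (x + y) \<in> A"
        using U xy(3) by (auto simp: U_def intro: mult_closed[OF add_closed[OF _ one_closed]])
      ultimately have "inverse y \<in> A" by simp
      thus False using xy False by (auto simp: U_def)
    qed
    with xy' show ?thesis by blast
  qed (use that in auto)
  show ?thesis
    using *[of x y] *[of y x] assms valuation_ring[of "x * inverse y"]
    by (auto simp: inverse_mult_distrib mult.commute add.commute)
qed

lemma nonunit_sum:
  "finite I \<Longrightarrow> (\<And>i. i \<in> I \<Longrightarrow> f i \<in> A - U) \<Longrightarrow> sum f I \<in> A - U"
proof (induction I rule: finite_induct)
  case empty
  thus ?case by (simp add: zero_closed U_def)
next
  case (insert i I)
  thus ?case using nonunit_add[of "f i" "sum f I"] by simp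
qed

lemma exists_max:
  assumes "finite I" "I \<noteq> {}" "\<And>i. i \<in> I \<Longrightarrow> f i \<noteq> 0"
  shows "\<exists>m\<in>I. \<forall>i\<in>I. f i * inverse (f m) \<in> A"
  using assms
proof (induction I rule: finite_ne_induct)
  case (singleton i)
  thus ?case by (simp add: one_closed)
next
  case (insert j I)
  then obtain m where m: "m \<in> I" "\<forall>i\<in>I. f i * inverse (f m) \<in> A" by auto
  show ?case
  proof (cases "f j * inverse (f m) \<in> A")
    case True
    thus ?thesis using m by blast
  next
    case False
    hence *: "f m * inverse (f j) \<in> A"
      using valuation_ring[of "f j * inverse (f m)"] by (simp add: mult.commute inverse_mult_distrib)
    have "f i * inverse (f j) \<in> A" if "i \<in> I" for i
    proof -
      have "f i * inverse (f j) = (f i * inverse (f m)) * (f m * inverse (f j))"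
        using insert.prems m(1) by (simp add: field_simps)
      also have "\<dots> \<in> A"
        using m(2) that by (intro mult_closed[OF _ *]) blast
      finally show ?thesis .
    qed
    moreover have "f j * inverse (f j) \<in> A" using insert.prems one_closed by simp
    ultimately show ?thesis by auto
  qed
qed

lemma power_value:
  assumes "x \<noteq> 0"
  obtains n c where "n > 0" "c \<noteq> 0" "x ^ n * inverse (to_ac c) \<in> U"
proof -
  obtain p :: "'a poly" where p: "p \<noteq> 0" "poly (map_poly to_ac p) x = 0"
    using alg_closure_algebraic[of x] by blast
  define I where "I = {i. i \<le> degree p \<and> coeff p i \<noteq> 0}"
  define f where "f = (\<lambda>i. to_ac (coeff p i) * x ^ i)"
  have I: "finite I" "I \<noteq> {}"
    unfolding I_def using p(1) by (auto intro!: exI[of _ "degree p"])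
  have f0: "f i \<noteq> 0" if "i \<in> I" for i
    using that assms by (auto simp: I_def f_def)
  have "\<exists>m\<in>I. \<forall>i\<in>I. f i * inverse (f m) \<in> A"
    by (rule exists_max[OF I f0])
  then obtain m where m: "m \<in> I" "\<forall>i\<in>I. f i * inverse (f m) \<in> A"
    by (elim bexE)
  have "0 = (\<Sum>i\<le>degree p. f i)"
    using p(2) by (simp add: poly_altdef f_def coeff_map_poly degree_map_poly)
  also have "\<dots> = sum f I"
    by (intro sum.mono_neutral_right) (auto simp: I_def f_def)
  also have "\<dots> = f m + sum f (I - {m})"
    using I m by (simp add: sum.remove)
  finally have "sum f (I - {m}) = - f m" by (simp add: eq_neg_iff_add_eq_0 add.commute)
  hence "(\<Sum>i\<in>I - {m}. f i * inverse (f m)) = -1"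
    using f0[OF m(1)] by (simp flip: sum_distrib_right)
  moreover have "-1 \<notin> A - U"
    using minus_closed[OF one_closed] by (auto simp: U_def)
  ultimately obtain i where i: "i \<in> I" "i \<noteq> m" "f i * inverse (f m) \<in> U"
    using nonunit_sum[of "I - {m}" "\<lambda>i. f i * inverse (f m)"] I(1) m(2) by auto
  define a where "a = coeff p i"
  define b where "b = coeff p m"
  have ab: "a \<noteq> 0" "b \<noteq> 0" using i m by (auto simp: a_def b_def I_def)
  have u: "to_ac a * x ^ i * inverse (to_ac b * x ^ m) \<in> U"
    using i by (simp add: f_def a_def b_def)
  show ?thesis
  proof (cases "i > m")
    case True
    have "to_ac a * x ^ i * inverse (to_ac b * x ^ m) = x ^ (i - m) * inverse (to_ac (b / a))"
      using True ab assms by (simp add: power_diff field_simps)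
    thus ?thesis using that[of "i - m" "b / a"] u True ab by simp
  next
    case False
    hence im: "m > i" using i by simp
    have "inverse (to_ac a * x ^ i * inverse (to_ac b * x ^ m)) =
            x ^ (m - i) * inverse (to_ac (a / b))"
      using im ab assms by (simp add: power_diff field_simps)
    thus ?thesis using that[of "m - i" "a / b"] inverse_U[OF u] im ab by simp
  qed
qed

definition R :: "'a alg_closure \<Rightarrow> nat \<Rightarrow> 'a \<Rightarrow> bool" where
  "R x n c \<longleftrightarrow> n > 0 \<and> c \<noteq> 0 \<and> x ^ n * inverse (to_ac c) \<in> U"

lemma R_exists: "x \<noteq> 0 \<Longrightarrow> \<exists>n c. R x n c"
  unfolding R_def using power_value by metis

lemma R_nonzero: "R x n c \<Longrightarrow> x \<noteq> 0"
  unfolding R_def U_def by auto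

lemma root_power_same: "n > 0 \<Longrightarrow> m > 0 \<Longrightarrow> r \<ge> 0 \<Longrightarrow> root (n * m) (r ^ n) = root m r"
  by (subst mult.commute) (simp add: real_root_mult_exp real_root_power_cancel)

lemma R_unique:
  assumes "R x n c" "R x m d"
  shows "root n (vabs c) = root m (vabs d)"
proof -
  have nm: "n > 0" "m > 0" "c \<noteq> 0" "d \<noteq> 0" and x: "x \<noteq> 0"
    using assms R_nonzero unfolding R_def by auto
  have "(x ^ n * inverse (to_ac c)) ^ m \<in> U" "inverse ((x ^ m * inverse (to_ac d)) ^ n) \<in> U"
    using assms by (auto simp: R_def intro!: power_U inverse_U)
  from mult_U[OF this] have "(x ^ n * inverse (to_ac c)) ^ m * inverse ((x ^ m * inverse (to_ac d)) ^ n) \<in> U" .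
  also have "(x ^ n * inverse (to_ac c)) ^ m * inverse ((x ^ m * inverse (to_ac d)) ^ n) =
               to_ac (d ^ n / c ^ m)"
    using nm x by (simp add: power_mult_distrib field_simps flip: power_mult)
  finally have "vabs (d ^ n / c ^ m) = 1"
    by (simp only: to_ac_U)
  hence "vabs d ^ n = vabs c ^ m"
    using nm vabs_eq_0[of c] by (simp add: vabs_divide vabs_power field_simps)
  hence "root (n * m) (vabs d ^ n) = root (n * m) (vabs c ^ m)" by simp
  thus ?thesis
    using nm root_power_same[of n m "vabs d"] root_power_same[of m n "vabs c"]
    by (simp add: vabs_nonneg mult.commute[of n m])
qed

definition N :: "'a alg_closure \<Rightarrow> real" where
  "N x = (if x = 0 then 0 else (SOME r. \<exists>n c. R x n c \<and> r = root n (vabs c)))"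

lemma N_eq:
  assumes "R x n c"
  shows "N x = root n (vabs c)"
proof -
  have "\<exists>r. \<exists>n c. R x n c \<and> r = root n (vabs c)" using assms by blast
  from someI_ex[OF this] show ?thesis
    using R_unique[OF assms] R_nonzero[OF assms] by (auto simp: N_def)
qed

lemma N_nonneg: "N x \<ge> 0"
proof (cases "x = 0")
  case False
  then obtain n c where "R x n c" using R_exists by blast
  thus ?thesis by (auto simp: N_eq vabs_nonneg R_def)
qed (auto simp: N_def)

lemma N_eq_0: "N x = 0 \<longleftrightarrow> x = 0"
proof (cases "x = 0")
  case False
  then obtain n c where "R x n c" using R_exists by blast
  thus ?thesis using False by (auto simp: N_eq R_def vabs_eq_0)
qed (auto simp: N_def)

lemma N_mult: "N (x * y) = N x * N y"
proof (cases "x = 0 \<or> y = 0")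
  case False
  then obtain n c m d where R: "R x n c" "R y m d" using R_exists by meson
  have pos: "n > 0" "m > 0" "c \<noteq> 0" "d \<noteq> 0" using R by (auto simp: R_def)
  have "(x ^ n * inverse (to_ac c)) ^ m * (y ^ m * inverse (to_ac d)) ^ n \<in> U"
    using R by (auto simp: R_def intro!: power_U mult_U)
  also have "(x ^ n * inverse (to_ac c)) ^ m * (y ^ m * inverse (to_ac d)) ^ n =
               (x * y) ^ (n * m) * inverse (to_ac (c ^ m * d ^ n))"
    by (simp add: power_mult_distrib power_inverse mult_ac flip: power_mult)
  finally have "R (x * y) (n * m) (c ^ m * d ^ n)"
    using pos by (simp add: R_def)
  hence "N (x * y) = root (n * m) (vabs c ^ m) * root (n * m) (vabs d ^ n)"
    by (simp add: N_eq vabs_mult vabs_power real_root_mult)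
  also have "root (n * m) (vabs c ^ m) = root n (vabs c)"
    using pos root_power_same[of m n "vabs c"] by (simp add: vabs_nonneg mult.commute[of n m])
  also have "root (n * m) (vabs d ^ n) = root m (vabs d)"
    using pos root_power_same[of n m "vabs d"] by (simp add: vabs_nonneg)
  finally show ?thesis using R by (simp add: N_eq)
qed (auto simp: N_def)

lemma N_to_ac: "N (to_ac c) = vabs c"
proof (cases "c = 0")
  case False
  hence "R (to_ac c) 1 c" by (simp add: R_def one_U)
  thus ?thesis by (simp add: N_eq)
qed (auto simp: N_def)

lemma N_le_1_iff: "N x \<le> 1 \<longleftrightarrow> x \<in> A"
proof (cases "x = 0")
  case False
  then obtain n c where R: "R x n c" using R_exists by blast
  hence pos: "n > 0" "c \<noteq> 0" by (auto simp: R_def)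
  have "N x \<le> 1 \<longleftrightarrow> vabs c \<le> 1"
    using R pos by (simp add: N_eq)
  also have "\<dots> \<longleftrightarrow> x ^ n \<in> A"
  proof -
    have "to_ac c = x ^ n * inverse (x ^ n * inverse (to_ac c))"
      "x ^ n = to_ac c * (x ^ n * inverse (to_ac c))"
      using pos False by (simp_all add: field_simps)
    moreover have "x ^ n * inverse (to_ac c) \<in> A" "inverse (x ^ n * inverse (to_ac c)) \<in> A"
      using R by (auto simp: R_def U_def)
    ultimately show ?thesis using mult_closed to_ac_iff[of c] by metis
  qed
  also have "\<dots> \<longleftrightarrow> x \<in> A"
  proof
    assume *: "x ^ n \<in> A"
    show "x \<in> A"
    proof (rule ccontr)
      assume "x \<notin> A"
      hence "inverse x \<in> A" using valuation_ring by blast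
      hence "x ^ n * inverse x ^ (n - 1) \<in> A"
        by (rule mult_closed[OF * power_closed])
      moreover have "x ^ n * inverse x ^ (n - 1) = x"
        using pos False by (cases n) (simp_all add: power_inverse mult.assoc)
      ultimately show False using \<open>x \<notin> A\<close> by simp
    qed
  qed (auto intro: power_closed)
  finally show ?thesis .
qed (auto simp: N_def zero_closed)

lemma N_add: "N (x + y) \<le> max (N x) (N y)"
proof -
  have *: "N (x + y) \<le> N y" if "N x \<le> N y" for x y
  proof (cases "y = 0")
    case True
    thus ?thesis using that N_nonneg[of x] N_eq_0[of x] N_eq_0[of y] by simp
  next
    case False
    hence y: "N y > 0" using N_nonneg[of y] N_eq_0[of y] by simp
    have "N (x / y) * N y = N x" using False by (simp flip: N_mult)
    hence "N (x / y) * N y \<le> 1 * N y" using that by simp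
    hence "N (x / y) \<le> 1" using y by (rule mult_right_le_imp_le)
    hence "x / y + 1 \<in> A" by (simp add: N_le_1_iff add_closed one_closed)
    hence "N (x / y + 1) \<le> 1" by (simp add: N_le_1_iff)
    hence "N (x / y + 1) * N y \<le> N y" using y by simp
    also have "N (x / y + 1) * N y = N (x + y)"
      using False by (simp add: field_simps flip: N_mult)
    finally show ?thesis .
  qed
  show ?thesis
    using *[of x y] *[of y x] by (cases "N x \<le> N y") (auto simp: add.commute)
qed

lemma extends_vabs_N: "extends_vabs N"
  unfolding extends_vabs_def
  using N_nonneg N_eq_0 N_mult N_add N_to_ac by blast

end

theorem extends_vabs_exists: "\<exists>N :: 'a :: nonarch_field alg_closure \<Rightarrow> real. extends_vabs N"
proof -
  have "\<exists>A \<in> {A :: 'a alg_closure set. dom_ring A}. \<forall>B\<in>{A. dom_ring A}. A \<subseteq> B \<longrightarrow> B = A"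
  proof (rule subset_Zorn_nonempty)
    show "{A :: 'a alg_closure set. dom_ring A} \<noteq> {}"
      using dom_ring_base by blast
    show "\<Union>C \<in> {A. dom_ring A}" if "C \<noteq> {}" "subset.chain {A. dom_ring A} C"
      for C :: "'a alg_closure set set"
      using dom_ring_Union[OF that] by simp
  qed
  then obtain A :: "'a alg_closure set" where "max_dom_ring A"
    unfolding max_dom_ring_def by blast
  thus ?thesis using max_dom_ring.extends_vabs_N by blast
qed

text \<open>
  If the base field is complete (as for the \<open>p\<close>-adic numbers below), the extension is unique, so the
  description operator makes no actual choice.
\<close>

definition alg_closure_vabs :: "'a :: nonarch_field alg_closure \<Rightarrow> real" where
  "alg_closure_vabs = (SOME N. extends_vabs N)"

lemma extends_alg_closure_vabs: "extends_vabs alg_closure_vabs"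
  unfolding alg_closure_vabs_def by (rule someI_ex[OF extends_vabs_exists])

lemma alg_closure_vabs:
  "alg_closure_vabs x \<ge> 0"
  "alg_closure_vabs x = 0 \<longleftrightarrow> x = 0"
  "alg_closure_vabs (x * y) = alg_closure_vabs x * alg_closure_vabs y"
  "alg_closure_vabs (x + y) \<le> max (alg_closure_vabs x) (alg_closure_vabs y)"
  "alg_closure_vabs (to_ac z) = vabs z"
  using extends_alg_closure_vabs unfolding extends_vabs_def by blast+

instantiation alg_closure :: (nonarch_field) metric_space
begin

definition dist_alg_closure :: "'a alg_closure \<Rightarrow> 'a alg_closure \<Rightarrow> real" where
  "dist_alg_closure x y = alg_closure_vabs (x - y)"

definition uniformity_alg_closure :: "('a alg_closure \<times> 'a alg_closure) filter" where
  "uniformity_alg_closure = (INF e\<in>{0<..}. principal {(x, y). dist x y < e})"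

definition open_alg_closure :: "'a alg_closure set \<Rightarrow> bool" where
  "open_alg_closure U \<longleftrightarrow> (\<forall>x\<in>U. eventually (\<lambda>(x', y). x' = x \<longrightarrow> y \<in> U) uniformity)"

instance
  by standard
     (simp_all add: dist_alg_closure_def uniformity_alg_closure_def open_alg_closure_def
        nonarch_metricI[where N = alg_closure_vabs, OF alg_closure_vabs(1-4)])

end

instantiation alg_closure :: (nonarch_field) nonarch_field
begin

definition vabs_alg_closure :: "'a alg_closure \<Rightarrow> real" where
  "vabs_alg_closure = alg_closure_vabs"

instance
  by standard (simp_all add: dist_alg_closure_def vabs_alg_closure_def alg_closure_vabs)

end

lemma vabs_to_ac [simp]: "vabs (to_ac x) = vabs x"
  by (simp add: vabs_alg_closure_def alg_closure_vabs)

definition rat_padic_abs :: "nat \<Rightarrow> rat \<Rightarrow> real" where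
  "rat_padic_abs p x = (if x = 0 then 0 else case quotient_of x of (a, b) \<Rightarrow>
     real p powi (int (multiplicity (int p) b) - int (multiplicity (int p) a)))"

lemma rat_padic_abs_divide:
  assumes "prime p" "a \<noteq> 0" "b \<noteq> 0"
  shows "rat_padic_abs p (of_int a / of_int b) =
           real p powi (int (multiplicity (int p) b) - int (multiplicity (int p) a))"
proof -
  obtain c d where cd: "quotient_of (of_int a / of_int b) = (c, d)"
    by (cases "quotient_of (of_int a / of_int b)")
  have d: "d > 0" using quotient_of_denom_pos[OF cd] .
  have eq: "of_int a / of_int b = (of_int c / of_int d :: rat)"
    using quotient_of_div[OF cd] .
  hence "of_int (a * d) = (of_int (c * b) :: rat)"
    using assms d by (simp add: field_simps)
  hence ad: "a * d = c * b" by (simp only: of_int_eq_iff)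
  have "c \<noteq> 0" using ad assms d by auto
  have "prime_elem (int p)" using assms by simp
  hence "multiplicity (int p) a + multiplicity (int p) d = multiplicity (int p) c + multiplicity (int p) b"
    using ad assms d \<open>c \<noteq> 0\<close> by (simp flip: prime_elem_multiplicity_mult_distrib)
  hence "int (multiplicity (int p) b) - int (multiplicity (int p) a) =
           int (multiplicity (int p) d) - int (multiplicity (int p) c)"
    by simp
  thus ?thesis
    using assms by (simp add: rat_padic_abs_def cd)
qed

lemma rat_padic_abs_nonneg: "rat_padic_abs p x \<ge> 0"
  by (auto simp: rat_padic_abs_def split: prod.splits)

lemma rat_padic_abs_eq_0: "prime p \<Longrightarrow> rat_padic_abs p x = 0 \<longleftrightarrow> x = 0"
  by (auto simp: rat_padic_abs_def power_int_eq_0_iff split: prod.splits)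

lemma rat_eq_divideE:
  obtains a b where "b \<noteq> 0" "x = of_int a / (of_int b :: rat)"
proof -
  obtain a b where ab: "quotient_of x = (a, b)" by (cases "quotient_of x")
  show ?thesis
    using that[of b a] quotient_of_div[OF ab] quotient_of_denom_pos[OF ab] by simp
qed

lemma rat_padic_abs_mult:
  assumes p: "prime p"
  shows "rat_padic_abs p (x * y) = rat_padic_abs p x * rat_padic_abs p y"
proof (cases "x = 0 \<or> y = 0")
  case False
  obtain a b where x: "b \<noteq> 0" "x = of_int a / of_int b" by (rule rat_eq_divideE)
  obtain c d where y: "d \<noteq> 0" "y = of_int c / of_int d" by (rule rat_eq_divideE)
  have nz: "a \<noteq> 0" "c \<noteq> 0" using x y False by auto
  have "x * y = of_int (a * c) / of_int (b * d)" by (simp add: x y)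
  hence "rat_padic_abs p (x * y) =
      real p powi (int (multiplicity (int p) (b * d)) - int (multiplicity (int p) (a * c)))"
    using rat_padic_abs_divide[OF p, of "a * c" "b * d"] x y nz by simp
  also have "int (multiplicity (int p) (b * d)) - int (multiplicity (int p) (a * c)) =
     (int (multiplicity (int p) b) - int (multiplicity (int p) a)) +
     (int (multiplicity (int p) d) - int (multiplicity (int p) c))"
    using x y nz p by (simp add: prime_elem_multiplicity_mult_distrib)
  also have "real p powi \<dots> = rat_padic_abs p x * rat_padic_abs p y"
    using p x y nz by (subst power_int_add) (auto simp: rat_padic_abs_divide)
  finally show ?thesis .
qed (auto simp: rat_padic_abs_def)

lemma rat_padic_abs_add:
  assumes p: "prime p"
  shows "rat_padic_abs p (x + y) \<le> max (rat_padic_abs p x) (rat_padic_abs p y)"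
proof (cases "x = 0 \<or> y = 0 \<or> x + y = 0")
  case False
  obtain a b where x: "b \<noteq> 0" "x = of_int a / of_int b" by (rule rat_eq_divideE)
  obtain c d where y: "d \<noteq> 0" "y = of_int c / of_int d" by (rule rat_eq_divideE)
  define e f g where "e = a * d" and "f = c * b" and "g = b * d"
  have g: "g \<noteq> 0" using x y by (simp add: g_def)
  have xy: "x = of_int e / of_int g" "y = of_int f / of_int g" "x + y = of_int (e + f) / of_int g"
    using x y by (simp_all add: e_def f_def g_def field_simps)
  have nz: "e \<noteq> 0" "f \<noteq> 0" "e + f \<noteq> 0" using False xy by auto
  define m where "m = min (multiplicity (int p) e) (multiplicity (int p) f)"
  have "int p ^ m dvd e + f"
    by (intro dvd_add multiplicity_dvd') (auto simp: m_def)
  moreover have "\<not> is_unit (int p)" using p by auto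
  ultimately have "multiplicity (int p) (e + f) \<ge> m"
    using nz by (intro multiplicity_geI) auto
  hence "real p powi (int (multiplicity (int p) g) - int (multiplicity (int p) (e + f))) \<le>
         real p powi (int (multiplicity (int p) g) - int m)"
    using prime_ge_1_nat[OF p] by (intro power_int_increasing) auto
  also have "\<dots> \<le> max (rat_padic_abs p x) (rat_padic_abs p y)"
    unfolding xy(1,2) rat_padic_abs_divide[OF p nz(1) g] rat_padic_abs_divide[OF p nz(2) g]
    by (auto simp: m_def min_def)
  finally show ?thesis
    unfolding xy(3) rat_padic_abs_divide[OF p nz(3) g] .
qed (auto simp: rat_padic_abs_def rat_padic_abs_nonneg max_def split: prod.splits)

text \<open>
  The prime \<open>p\<close> is represented by a type with \<open>p\<close> elements; every prime is the cardinality of some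
  type, so a free type variable of this class amounts to an arbitrary prime.
\<close>

class prime_card = finite +
  assumes prime_card: "prime CARD('a)"

text \<open>
  A copy of the rationals, which will carry the \<open>p\<close>-adic metric for \<open>p = CARD('p)\<close>.
\<close>

typedef 'p padic_rat = "UNIV :: rat set" ..

setup_lifting type_definition_padic_rat

instantiation padic_rat :: (type) field
begin

lift_definition zero_padic_rat :: "'a padic_rat" is 0 .
lift_definition one_padic_rat :: "'a padic_rat" is 1 .
lift_definition plus_padic_rat :: "'a padic_rat \<Rightarrow> 'a padic_rat \<Rightarrow> 'a padic_rat" is "(+)" .
lift_definition minus_padic_rat :: "'a padic_rat \<Rightarrow> 'a padic_rat \<Rightarrow> 'a padic_rat" is "(-)" .
lift_definition uminus_padic_rat :: "'a padic_rat \<Rightarrow> 'a padic_rat" is "uminus" .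
lift_definition times_padic_rat :: "'a padic_rat \<Rightarrow> 'a padic_rat \<Rightarrow> 'a padic_rat" is "(*)" .
lift_definition divide_padic_rat :: "'a padic_rat \<Rightarrow> 'a padic_rat \<Rightarrow> 'a padic_rat" is "(/)" .
lift_definition inverse_padic_rat :: "'a padic_rat \<Rightarrow> 'a padic_rat" is inverse .

instance
  by standard (transfer; simp add: algebra_simps divide_inverse)+

end

lemma Rep_padic_rat_of_nat: "Rep_padic_rat (of_nat n) = of_nat n"
  by (induction n) (simp_all add: zero_padic_rat.rep_eq one_padic_rat.rep_eq plus_padic_rat.rep_eq)

instance padic_rat :: (type) field_char_0
proof
  show "inj (of_nat :: nat \<Rightarrow> 'a padic_rat)"
    by (rule injI) (metis Rep_padic_rat_of_nat of_nat_eq_iff)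
qed

lift_definition padic_rat_abs :: "'p :: prime_card padic_rat \<Rightarrow> real"
  is "rat_padic_abs CARD('p)" .

lemma padic_rat_abs:
  "padic_rat_abs x \<ge> 0"
  "padic_rat_abs x = 0 \<longleftrightarrow> x = 0"
  "padic_rat_abs (x * y) = padic_rat_abs x * padic_rat_abs y"
  "padic_rat_abs (x + y) \<le> max (padic_rat_abs x) (padic_rat_abs y)"
  by (transfer; intro rat_padic_abs_nonneg rat_padic_abs_eq_0 rat_padic_abs_mult rat_padic_abs_add
        prime_card)+

instantiation padic_rat :: (prime_card) metric_space
begin

definition dist_padic_rat :: "'a padic_rat \<Rightarrow> 'a padic_rat \<Rightarrow> real" where
  "dist_padic_rat x y = padic_rat_abs (x - y)"

definition uniformity_padic_rat :: "('a padic_rat \<times> 'a padic_rat) filter" where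
  "uniformity_padic_rat = (INF e\<in>{0<..}. principal {(x, y). dist x y < e})"

definition open_padic_rat :: "'a padic_rat set \<Rightarrow> bool" where
  "open_padic_rat U \<longleftrightarrow> (\<forall>x\<in>U. eventually (\<lambda>(x', y). x' = x \<longrightarrow> y \<in> U) uniformity)"

instance
  by standard
     (simp_all add: dist_padic_rat_def uniformity_padic_rat_def open_padic_rat_def
        nonarch_metricI[where N = padic_rat_abs, OF padic_rat_abs])

end

instantiation padic_rat :: (prime_card) nonarch_field
begin

definition vabs_padic_rat :: "'a padic_rat \<Rightarrow> real" where
  "vabs_padic_rat = padic_rat_abs"

instance
  by standard (simp_all add: dist_padic_rat_def vabs_padic_rat_def padic_rat_abs)

end

text \<open>
  \<open>\<rat>\<^sub>p\<close> is the completion of \<open>\<rat>\<close>, \<open>\<complex>\<^sub>p\<close> the completion of the algebraic closure of \<open>\<rat>\<^sub>p\<close>, and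
  \<open>\<int>\<^sub>p\<close> the closed unit ball of \<open>\<rat>\<^sub>p\<close>.
\<close>

type_synonym 'p padic = "'p padic_rat completion"

type_synonym 'p padic_complex = "'p padic alg_closure completion"

typedef (overloaded) 'p padic_int = "{x :: 'p :: prime_card padic. vabs x \<le> 1}"
  by (rule exI[of _ 0]) simp

setup_lifting type_definition_padic_int

instantiation padic_int :: (prime_card) comm_ring_1
begin

lift_definition zero_padic_int :: "'a padic_int" is 0 by simp
lift_definition one_padic_int :: "'a padic_int" is 1 by simp
lift_definition plus_padic_int :: "'a padic_int \<Rightarrow> 'a padic_int \<Rightarrow> 'a padic_int" is "(+)"
proof -
  fix x y :: "'a padic"
  assume "vabs x \<le> 1" "vabs y \<le> 1"
  thus "vabs (x + y) \<le> 1" using vabs_add[of x y] by simp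
qed
lift_definition uminus_padic_int :: "'a padic_int \<Rightarrow> 'a padic_int" is uminus by simp
lift_definition minus_padic_int :: "'a padic_int \<Rightarrow> 'a padic_int \<Rightarrow> 'a padic_int" is "(-)"
proof -
  fix x y :: "'a padic"
  assume "vabs x \<le> 1" "vabs y \<le> 1"
  thus "vabs (x - y) \<le> 1" using vabs_add[of x "- y"] by simp
qed
lift_definition times_padic_int :: "'a padic_int \<Rightarrow> 'a padic_int \<Rightarrow> 'a padic_int" is "(*)"
  by (simp add: vabs_mult vabs_nonneg mult_le_one)

instance
  by standard (transfer; simp add: algebra_simps)+

end

instantiation padic_int :: (prime_card) metric_space
begin

lift_definition dist_padic_int :: "'a padic_int \<Rightarrow> 'a padic_int \<Rightarrow> real" is dist .

definition uniformity_padic_int :: "('a padic_int \<times> 'a padic_int) filter" where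
  "uniformity_padic_int = (INF e\<in>{0<..}. principal {(x, y). dist x y < e})"

definition open_padic_int :: "'a padic_int set \<Rightarrow> bool" where
  "open_padic_int U \<longleftrightarrow> (\<forall>x\<in>U. eventually (\<lambda>(x', y). x' = x \<longrightarrow> y \<in> U) uniformity)"

instance
proof
  fix x y z :: "'a padic_int"
  show "dist x y = 0 \<longleftrightarrow> x = y" by transfer simp
  show "dist x y \<le> dist x z + dist y z" by transfer (rule dist_triangle2)
qed (simp_all add: uniformity_padic_int_def open_padic_int_def)

end

definition of_padic_int :: "'p :: prime_card padic_int \<Rightarrow> 'p padic_complex" where
  "of_padic_int x = to_completion (to_ac (Rep_padic_int x))"

lemma of_padic_int_hom:
  "of_padic_int 0 = 0" "of_padic_int 1 = 1"
  "of_padic_int (x + y) = of_padic_int x + of_padic_int y"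
  "of_padic_int (x * y) = of_padic_int x * of_padic_int y"
  by (simp_all add: of_padic_int_def zero_padic_int.rep_eq one_padic_int.rep_eq
        plus_padic_int.rep_eq times_padic_int.rep_eq)

lemma of_padic_int_of_nat: "of_padic_int (of_nat n) = of_nat n"
  by (induction n) (simp_all add: of_padic_int_hom)

lemma vabs_of_padic_int: "vabs (of_padic_int x) \<le> 1"
  using Rep_padic_int[of x] by (simp add: of_padic_int_def)

lemma vabs_CARD: "vabs (of_nat CARD('p) :: 'p :: prime_card padic_complex) = 1 / CARD('p)"
proof -
  have p: "prime CARD('p)" by (rule prime_card)
  have "vabs (of_nat CARD('p) :: 'p padic_rat) = rat_padic_abs CARD('p) (of_nat CARD('p))"
    by (simp add: vabs_padic_rat_def padic_rat_abs.rep_eq Rep_padic_rat_of_nat)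
  also have "\<dots> = 1 / CARD('p)"
    using p rat_padic_abs_divide[OF p, of "int CARD('p)" 1]
    by (simp add: multiplicity_self power_int_minus divide_inverse)
  also have "vabs (of_nat CARD('p) :: 'p padic_rat) =
      vabs (to_completion (to_ac (to_completion (of_nat CARD('p) :: 'p padic_rat))))"
    by (simp only: vabs_to_completion vabs_to_ac)
  also have "to_completion (to_ac (to_completion (of_nat CARD('p) :: 'p padic_rat))) =
      (of_nat CARD('p) :: 'p padic_complex)"
    by simp
  finally show ?thesis .
qed

definition fermionic_sum ::
  "('p :: prime_card padic_int \<Rightarrow> 'p padic_complex) \<Rightarrow> nat \<Rightarrow> 'p padic_complex" where
  "fermionic_sum f N = (\<Sum>x<CARD('p) ^ N. f (of_nat x) * (-1) ^ x)"

text \<open>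
  The integral is only meant for continuous functions whose sums converge; \<open>lim\<close> is unspecified
  for divergent sequences.
\<close>

definition fermionic_integrable ::
  "('p :: prime_card padic_int \<Rightarrow> 'p padic_complex) \<Rightarrow> bool" where
  "fermionic_integrable f \<longleftrightarrow> continuous_on UNIV f \<and> convergent (fermionic_sum f)"

definition fermionic_integral ::
  "('p :: prime_card padic_int \<Rightarrow> 'p padic_complex) \<Rightarrow> 'p padic_complex" where
  "fermionic_integral f = lim (fermionic_sum f)"

definition catalan :: "nat \<Rightarrow> 'a :: field_char_0" where
  "catalan n = 1 / of_nat (n + 1) * of_nat ((2 * n) choose n)"

end

theory Submission
  imports Defs
begin

text \<open>
  With \<open>G(x) = binom((x+1)/2, n+1) - binom(x/2, n+1)\<close>, Pascal's rule gives
  \<open>G(x+1) + G(x) = binom(x/2, n)\<close>. The fermionic sums therefore telescope to \<open>G(0) + G(p\<^sup>N)\<close>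
  (\<open>p\<^sup>N\<close> is odd), which tends to \<open>2 G(0) = 2 binom(1/2, n+1)\<close>.
\<close>

text \<open>Reduces limits along any filter to real-valued estimates, where sandwich arguments
  apply.\<close>

lemma tendsto_vabs_iff:
  fixes f :: "'b \<Rightarrow> 'a :: nonarch_field"
  shows "(f \<longlongrightarrow> a) F \<longleftrightarrow> ((\<lambda>x. vabs (f x - a)) \<longlongrightarrow> 0) F"
  by (subst tendsto_dist_iff) (simp add: dist_vabs)

text \<open>Lets the generic limit and continuity rules treat sums and differences in
  \<open>'p padic_complex\<close>; the ordinary triangle inequality is enough.\<close>

instance nonarch_field \<subseteq> topological_ab_group_add
proof
  fix a b :: 'a
  have "((\<lambda>x. vabs (fst x - a) + vabs (snd x - b)) \<longlongrightarrow> 0) (nhds a \<times>\<^sub>F nhds b)"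
    by (intro tendsto_add_zero; subst tendsto_vabs_iff [symmetric])
       (simp_all add: filterlim_def filtermap_fst_prod_filter filtermap_snd_prod_filter)
  thus "((\<lambda>x. fst x + snd x) \<longlongrightarrow> a + b) (nhds a \<times>\<^sub>F nhds b)"
    unfolding tendsto_vabs_iff [of "\<lambda>x. fst x + snd x"]
    by (rule tendsto_sandwich[OF _ _ tendsto_const, rotated 2])
       (simp_all add: vabs_nonneg add_diff_add vabs_triangle)
next
  fix a :: 'a
  have "((\<lambda>x. vabs (x - a)) \<longlongrightarrow> 0) (nhds a)"
    by (subst tendsto_vabs_iff [symmetric]) (rule filterlim_ident)
  thus "(uminus \<longlongrightarrow> - a) (nhds a)"
    by (simp add: tendsto_vabs_iff [of uminus] vabs_minus_commute [of a])
qed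

text \<open>Supplies continuity of finite products, and so of polynomials such as binomial
  coefficients.\<close>

instance nonarch_field \<subseteq> topological_comm_monoid_mult
proof
  fix a b :: 'a
  let ?F = "nhds a \<times>\<^sub>F nhds b"
  let ?u = "\<lambda>x :: 'a \<times> 'a. vabs (fst x - a)" and ?v = "\<lambda>x :: 'a \<times> 'a. vabs (snd x - b)"
  have "(?u \<longlongrightarrow> 0) ?F" "(?v \<longlongrightarrow> 0) ?F"
    by (subst tendsto_vabs_iff [symmetric],
        simp add: filterlim_def filtermap_fst_prod_filter filtermap_snd_prod_filter)+
  hence lim: "((\<lambda>x. ?u x * ?v x + ?u x * vabs b + vabs a * ?v x) \<longlongrightarrow> 0) ?F"
    by (intro tendsto_add_zero tendsto_mult_zero tendsto_mult_left_zero tendsto_mult_right_zero)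
  have bound: "vabs (fst x * snd x - a * b) \<le> ?u x * ?v x + ?u x * vabs b + vabs a * ?v x" for x
  proof -
    \<comment> \<open>Every summand of this expansion contains a factor \<open>fst x - a\<close> or
      \<open>snd x - b\<close>, which tends to 0.\<close>
    have "fst x * snd x - a * b =
        (fst x - a) * (snd x - b) + (fst x - a) * b + a * (snd x - b)"
      by (simp add: algebra_simps)
    thus ?thesis
      unfolding vabs_mult [symmetric]
      by (simp only: order_trans [OF vabs_triangle add_right_mono [OF vabs_triangle]])
  qed
  show "((\<lambda>x. fst x * snd x) \<longlongrightarrow> a * b) ?F"
    unfolding tendsto_vabs_iff [of "\<lambda>x. fst x * snd x"]
    by (rule tendsto_sandwich[OF _ _ tendsto_const lim]) (simp_all add: vabs_nonneg bound)
qed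

lemma continuous_on_divide_const_nonarch:
  fixes f :: "'b :: topological_space \<Rightarrow> 'a :: nonarch_field"
  assumes "continuous_on A f"
  shows "continuous_on A (\<lambda>x. f x / c)"
  unfolding divide_inverse by (intro continuous_intros assms)

text \<open>For fixed \<open>n\<close> the coefficient is a finite product of translates of
  \<open>f x\<close>, divided by the constant \<open>fact n\<close>.\<close>

lemma continuous_on_gbinomial_nonarch:
  fixes f :: "'b :: topological_space \<Rightarrow> 'a :: nonarch_field"
  assumes "continuous_on A f"
  shows "continuous_on A (\<lambda>x. f x gchoose n)"
  unfolding gbinomial_prod_rev
  by (intro continuous_on_divide_const_nonarch continuous_intros assms)

text \<open>Both embeddings behind \<open>of_padic_int\<close> preserve \<open>vabs\<close>, so the
  map is an isometry.\<close>

lemma continuous_on_of_padic_int: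
  "continuous_on A (of_padic_int :: 'p :: prime_card padic_int \<Rightarrow> 'p padic_complex)"
proof -
  have "dist (of_padic_int y) (of_padic_int x) = dist y x" for x y :: "'p padic_int"
    by (simp add: of_padic_int_def dist_padic_int.rep_eq dist_vabs
          flip: to_completion_diff to_ac_diff)
  thus ?thesis
    unfolding continuous_on_def tendsto_dist_iff [of of_padic_int]
    by (simp flip: tendsto_dist_iff [of "\<lambda>y. y"])
qed

lemma tendsto_of_nat_CARD_power:
  "(\<lambda>N. of_nat (CARD('p) ^ N) :: 'p :: prime_card padic_complex) \<longlonglongrightarrow> 0"
proof -
  have "real CARD('p) > 1"
    using prime_gt_1_nat[OF prime_card[where 'a = 'p]] by simp
  hence "(\<lambda>N. (1 / real CARD('p)) ^ N) \<longlonglongrightarrow> 0"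
    by (intro LIMSEQ_realpow_zero) auto
  thus ?thesis
    by (simp add: null_seq_iff vabs_power vabs_CARD)
qed

text \<open>With \<open>H x = (- 1) ^ x * G x\<close>, each summand is
  \<open>H x - H (Suc x)\<close>.\<close>

lemma alternating_sum_telescope:
  fixes G :: "nat \<Rightarrow> 'a :: comm_ring_1"
  shows "(\<Sum>x<m. (G (Suc x) + G x) * (- 1) ^ x) = G 0 - (- 1) ^ m * G m"
  by (induction m) (auto simp: algebra_simps)

text \<open>Both sides equal 1 at \<open>n = 0\<close>, and passing from \<open>n\<close> to
  \<open>n + 1\<close> multiplies each by \<open>- (2 * n + 1) / (2 * (n + 2))\<close>.\<close>

lemma gbinomial_half_Suc:
  "2 * ((1 / 2) gchoose Suc n) = ((- 1) ^ n / 4 ^ n * catalan n :: 'a :: field_char_0)"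
proof (induction n)
  case (Suc n)
  \<comment> \<open>Recurrence for central binomial coefficients: two absorption steps, joined by
    the symmetry of row \<open>2 * n + 1\<close>.\<close>
  have "Suc n * (2 * Suc n choose Suc n) = 2 * (Suc n * (Suc (2 * n) choose n))"
    using Suc_times_binomial[of n "Suc (2 * n)"] by simp
  also have "Suc (2 * n) choose n = Suc (2 * n) choose Suc n"
    using binomial_symmetric[of n "Suc (2 * n)"] by (simp add: Suc_diff_le)
  also have "Suc n * \<dots> = Suc (2 * n) * (2 * n choose n)"
    by (rule Suc_times_binomial)
  finally have "of_nat (Suc n) * of_nat (2 * Suc n choose Suc n) =
      (2 * (of_nat (Suc (2 * n)) * of_nat (2 * n choose n)) :: 'a)"
    by (metis of_nat_mult of_nat_numeral)
  hence "catalan (Suc n) = (2 * of_nat (Suc (2 * n)) / of_nat (Suc (Suc n)) * catalan n :: 'a)"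
    by (simp add: catalan_def divide_simps del: of_nat_Suc binomial_Suc_Suc) (simp add: algebra_simps)
  moreover have "of_nat (Suc (Suc n)) * ((1 / 2) gchoose Suc (Suc n)) =
      (1 / 2 - of_nat (Suc n)) * ((1 / 2) gchoose Suc n :: 'a)"
    using gbinomial_mult_1[of "1 / 2 :: 'a" "Suc n"] by (simp only: algebra_simps)
  hence "2 * ((1 / 2) gchoose Suc (Suc n)) =
      (1 / 2 - of_nat (Suc n)) / of_nat (Suc (Suc n)) * (2 * ((1 / 2) gchoose Suc n) :: 'a)"
    by (simp add: divide_simps del: of_nat_Suc) (simp only: mult_ac)
  moreover have "1 / 2 - of_nat (Suc n) = (- of_nat (Suc (2 * n)) / 2 :: 'a)"
    by (simp add: field_simps)
  ultimately show ?case
    unfolding Suc.IH by (simp add: mult_ac del: of_nat_Suc)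
qed (simp add: catalan_def)

theorem theorem3:
  fixes n :: nat
  assumes "odd CARD('p::prime_card)"
  shows "fermionic_integrable (\<lambda>x :: 'p padic_int. (of_padic_int x / 2) gchoose n) \<and>
    fermionic_integral (\<lambda>x :: 'p padic_int. (of_padic_int x / 2) gchoose n) =
      (-1) ^ n / 4 ^ n * catalan n \<and>
    fermionic_integral (\<lambda>x :: 'p padic_int. (of_padic_int x / 2) gchoose n) =
      (-1) ^ n / (4 ^ n * of_nat (n + 1)) * of_nat ((2 * n) choose n)"
proof -
  define f where "f = (\<lambda>x :: 'p padic_int. (of_padic_int x / 2) gchoose n)"
  define G :: "'p padic_complex \<Rightarrow> 'p padic_complex" where
    "G = (\<lambda>x. ((x + 1) / 2 gchoose Suc n) - (x / 2 gchoose Suc n))"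
  have G_step: "G (x + 1) + G x = x / 2 gchoose n" for x
  proof -
    \<comment> \<open>In \<open>G (x + 1) + G x\<close> the terms at \<open>(x + 1) / 2\<close>
      cancel. What remains is a unit step in \<open>x / 2\<close>, to which Pascal's rule
      applies.\<close>
    have "(x + 1 + 1) / 2 = x / 2 + 1" by (simp add: field_simps)
    thus ?thesis by (simp only: G_def gbinomial_Suc_Suc) simp
  qed
  have sum_eq: "fermionic_sum f N = G 0 + G (of_nat (CARD('p) ^ N))" for N
  proof -
    have "fermionic_sum f N =
        (\<Sum>x<CARD('p) ^ N. (G (of_nat (Suc x)) + G (of_nat x)) * (- 1) ^ x)"
      by (simp add: fermionic_sum_def f_def of_padic_int_of_nat add.commute [of 1] flip: G_step)
    also have "\<dots> = G 0 + G (of_nat (CARD('p) ^ N))"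
      \<comment> \<open>The boundary sign is \<open>-1\<close> for every \<open>N\<close>, including
        \<open>N = 0\<close>, where the upper bound is 1.\<close>
      using assms by (subst alternating_sum_telescope) simp
    finally show ?thesis .
  qed
  have "continuous_on UNIV G"
    unfolding G_def
    by (intro continuous_intros continuous_on_gbinomial_nonarch continuous_on_divide_const_nonarch)
  \<comment> \<open>Although \<open>CARD('p) ^ N\<close> grows as an integer, it tends to 0 in the
    metric of \<open>'p padic_complex\<close>, so continuity of \<open>G\<close> gives the
    limit.\<close>
  hence "(\<lambda>N. G (of_nat (CARD('p) ^ N))) \<longlonglongrightarrow> G 0"
    by (rule continuous_on_tendsto_compose[OF _ tendsto_of_nat_CARD_power]) auto
  hence "fermionic_sum f \<longlonglongrightarrow> G 0 + G 0"
    unfolding sum_eq[abs_def] by (intro tendsto_intros)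
  also have "G 0 + G 0 = (-1) ^ n / 4 ^ n * catalan n"
    \<comment> \<open>The subtracted term of \<open>G 0\<close> vanishes, since
      \<open>0 gchoose Suc n\<close> is 0.\<close>
    by (simp add: G_def gbinomial_half_Suc flip: mult_2)
  finally have lim: "fermionic_sum f \<longlonglongrightarrow> (-1) ^ n / 4 ^ n * catalan n" .
  have cont: "continuous_on UNIV f"
    unfolding f_def
    by (intro continuous_on_gbinomial_nonarch
        continuous_on_divide_const_nonarch continuous_on_of_padic_int)
  have "fermionic_integrable f"
    using lim cont by (auto simp: fermionic_integrable_def convergent_def)
  moreover have "fermionic_integral f = (-1) ^ n / 4 ^ n * catalan n"
    using lim by (simp add: fermionic_integral_def limI)
  ultimately show ?thesis
    unfolding f_def by (simp add: catalan_def)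
qed

end
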